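(* Let $\lambda\in\{2,3\}$, let $d\ge \lambda$ and $k$ be integers with $k-\lambda\ge 2$, and let $n=d+2(k-\lambda)$. Let $X=\{x_1,\dots,x_n\}$ be a finite collection of points in $\mathbb{R}^d$. Then for every $\epsilon>0$ there exists a collection $X'=\{x'_1,\dots,x'_n\}$ of points in $\mathbb{R}^d$ in general position such that $|x_i-x'_i|<\epsilon$ for every $i=1,\dots,n$, and such that every $(d-\lambda)$-plane that is transversal to the convex hulls of all $k$-sets of $X'$ is complete, i.e. contains $d-\lambda+1$ points of $X'$.
   Context: A $j$-plane is a $j$-dimensional affine subspace of $\mathbb{R}^d$. A $k$-set of $X$ is a subset of $X$ with $k$ elements. A plane $L$ is transversal to a family of sets if it intersects every member of the family. A set of points in $\mathbb{R}^d$ is in general position if it is affinely in general position, i.e. every subset of at most $d+1$ of its points is affinely independent (in particular no $d+1$ of its points lie in a common hyperplane). *)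

theory Defs
  imports "HOL-Analysis.Analysis"
begin

definition is_plane :: "nat \<Rightarrow> 'a::euclidean_space set \<Rightarrow> bool" where
  "is_plane j L \<longleftrightarrow> affine L \<and> aff_dim L = int j"

definition k_sets :: "nat \<Rightarrow> 'a set \<Rightarrow> 'a set set" where
  "k_sets k X = {S. S \<subseteq> X \<and> finite S \<and> card S = k}"

definition transversal :: "'a set \<Rightarrow> 'a set set \<Rightarrow> bool" where
  "transversal L F \<longleftrightarrow> (\<forall>S\<in>F. L \<inter> S \<noteq> {})"

definition general_position :: "'a::euclidean_space set \<Rightarrow> bool" where
  "general_position X \<longleftrightarrow>
     (\<forall>S\<subseteq>X. finite S \<and> card S \<le> DIM('a) + 1 \<longrightarrow> \<not> affine_dependent S)"

text \<open>In general position, a \<open>j\<close>-plane contains at most \<open>j + 1\<close> points of \<open>X\<close>, so for such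
  \<open>X\<close> it makes no difference whether completeness asks for exactly or at least \<open>j + 1\<close> points.\<close>

definition complete_plane :: "nat \<Rightarrow> 'a set \<Rightarrow> 'a set \<Rightarrow> bool" where
  "complete_plane j X L \<longleftrightarrow> (\<exists>S\<in>k_sets (j + 1) X. S \<subseteq> L)"

end

theory Submission
  imports Defs
begin

text \<open>Let a transversal \<open>(d - l)\<close>-plane \<open>L\<close> contain \<open>m \<le> d - l\<close> of the points, and project along \<open>L\<close> to vectors
  \<open>v i\<close>. Transversality says that no open half-space contains \<open>k\<close> of the vectors; as
  \<open>n = d + 2 (k - l)\<close>, counting on both sides of a generic hyperplane gives \<open>m \<ge> d + 2 - 2 l\<close>.

  If equality holds, every generic hyperplane halves the nonzero vectors, so they form antipodal pairs. Thus
  \<open>L\<close> contains \<open>d + 2 - 2 l\<close> points and meets at least \<open>l + 1\<close> disjoint segments between other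
  points, which does not happen for an open dense set of tuples.

  The only other case is \<open>l = 3\<close>, \<open>m = d - 3\<close>. Discarding at most one pair of parallel vectors,
  the plane spanned by any two of the vectors \<open>p\<close>, \<open>q\<close> contains exactly one more, and that one is a negative
  combination of \<open>p\<close> and \<open>q\<close>. An infinite descent on triangles refutes this configuration.\<close>

text \<open>Write \<open>m\<close> for the number of points on the plane. At most
  \<open>k - 1\<close> of the nonzero vectors lie on each side of a generic hyperplane, so
  \<open>m \<ge> n - 2 * (k - 1) = d + 2 - 2 * l\<close>. Together with \<open>m \<le> d - l\<close>
  this leaves one value if \<open>l = 2\<close> and two if \<open>l = 3\<close>. The smaller value
  is excluded by a dimension count. A \<open>(d - l)\<close>-plane has
  \<open>l * (d - l + 1)\<close> degrees of freedom; each prescribed point costs \<open>l\<close>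
  and each segment \<open>l - 1\<close>, so the \<open>d + 2 - 2 * l\<close> points and
  \<open>l + 1\<close> segments exceed the freedom by \<open>l - 1 > 0\<close>. The obstacle is that
  the perturbed tuple must be fixed before any plane is given: the bad tuples have to form finitely
  many closed sets with dense complements. Closedness comes from compactness of the normals and
  segment parameters, density from moving a single endpoint. The larger value for
  \<open>l = 3\<close> needs no such avoidance: general position and signs alone refute it.\<close>

section \<open>Incidences between planes and segments\<close>

text \<open>A compact parameter space for the normals of a plane: only the first \<open>r\<close>
  vectors form an orthonormal system; the bound on all the others keeps the set inside a product of
  balls, so that Tychonoff's theorem applies.\<close>

definition frames :: "nat \<Rightarrow> (nat \<Rightarrow> 'a::euclidean_space) set" where
  "frames r = {u. (\<forall>j. norm (u j) \<le> 1) \<and> (\<forall>j<r. norm (u j) = 1) \<and>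
                  (\<forall>i<r. \<forall>j<r. i \<noteq> j \<longrightarrow> u i \<bullet> u j = 0)}"

lemma compact_UNIV_funcset:
  fixes K :: "'b::topological_space set"
  assumes "compact K"
  shows "compact {f :: 'i \<Rightarrow> 'b. \<forall>i. f i \<in> K}"
proof -
  have "compactin (product_topology (\<lambda>_::'i. euclidean::'b topology) UNIV) (PiE UNIV (\<lambda>_. K))"
    unfolding compactin_PiE using assms by simp
  moreover have "PiE UNIV (\<lambda>_. K) = {f :: 'i \<Rightarrow> 'b. \<forall>i. f i \<in> K}"
    by (auto simp: PiE_def)
  ultimately show ?thesis
    by (simp add: euclidean_product_topology)
qed

lemma compact_frames: "compact (frames r :: (nat \<Rightarrow> 'a::euclidean_space) set)"
proof -
  have "closed {u :: nat \<Rightarrow> 'a. (\<forall>j\<in>{..<r}. norm (u j) = 1) \<and>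
          (\<forall>i\<in>{..<r}. \<forall>j\<in>{..<r}. i \<noteq> j \<longrightarrow> u i \<bullet> u j = 0)}"
    unfolding Ball_def
    by (intro closed_Collect_conj closed_Collect_all closed_Collect_imp closed_Collect_eq
        continuous_intros open_Collect_const continuous_on_product_coordinates)
  then have "compact ({u :: nat \<Rightarrow> 'a. \<forall>j. u j \<in> cball 0 1} \<inter>
      {u. (\<forall>j\<in>{..<r}. norm (u j) = 1) \<and> (\<forall>i\<in>{..<r}. \<forall>j\<in>{..<r}. i \<noteq> j \<longrightarrow> u i \<bullet> u j = 0)})"
    by (intro compact_Int_closed compact_UNIV_funcset compact_cball)
  also have "\<dots> = frames r"
    by (auto simp: frames_def)
  finally show ?thesis .
qed

lemma dim_orthogonal_frame:
  fixes u :: "nat \<Rightarrow> 'a::euclidean_space"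
  assumes "u \<in> frames r"
  shows "int (dim {z. \<forall>j<r. u j \<bullet> z = 0}) = int DIM('a) - int r"
proof -
  let ?U = "u ` {..<r}"
  have n1: "norm (u j) = 1" if "j < r" for j using assms that by (simp add: frames_def)
  have orth: "u i \<bullet> u j = 0" if "i < r" "j < r" "i \<noteq> j" for i j
    using assms that by (simp add: frames_def)
  have inj: "inj_on u {..<r}"
  proof (rule inj_onI, rule ccontr)
    fix i j assume "i \<in> {..<r}" "j \<in> {..<r}" "u i = u j" "i \<noteq> j"
    then have "u i \<bullet> u i = 0" using orth[of i j] by simp
    then show False using n1[of i] \<open>i \<in> {..<r}\<close> by simp
  qed
  have "pairwise orthogonal ?U"
    using orth by (auto simp: pairwise_def orthogonal_def)
  moreover have "0 \<notin> ?U" using n1 by (metis imageE lessThan_iff norm_zero zero_neq_one)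
  ultimately have ind: "independent ?U" by (rule pairwise_orthogonal_independent)
  have dimU: "dim (span ?U) = r"
    using ind inj by (simp add: dim_eq_card_independent card_image)
  have "{z. \<forall>j<r. u j \<bullet> z = 0} = {y \<in> UNIV. \<forall>x \<in> span ?U. orthogonal x y}"
  proof (intro set_eqI iffI)
    fix z assume z: "z \<in> {z. \<forall>j<r. u j \<bullet> z = 0}"
    have "orthogonal z x" if "x \<in> span ?U" for x
      by (rule orthogonal_to_span[OF that]) (use z in \<open>auto simp: orthogonal_def inner_commute\<close>)
    then show "z \<in> {y \<in> UNIV. \<forall>x \<in> span ?U. orthogonal x y}"
      by (auto simp: orthogonal_commute)
  next
    fix z assume "z \<in> {y \<in> UNIV. \<forall>x \<in> span ?U. orthogonal x y}"
    then show "z \<in> {z. \<forall>j<r. u j \<bullet> z = 0}"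
      by (auto simp: orthogonal_def intro!: span_base)
  qed
  then have "dim {z. \<forall>j<r. u j \<bullet> z = 0} + dim (span ?U) = DIM('a)"
    using dim_subspace_orthogonal_to_vectors[of "span ?U" UNIV] by (simp add: subspace_UNIV)
  then show ?thesis using dimU by simp
qed

lemma affine_as_frame:
  fixes L :: "'a::euclidean_space set"
  assumes "affine L" "aff_dim L = int DIM('a) - int r" "p \<in> L"
  obtains u where "u \<in> frames r" "L = {y. \<forall>j<r. u j \<bullet> (y - p) = 0}"
proof -
  define S where "S = {y - p |y. y \<in> L}"
  have SL: "S = (\<lambda>y. y - p) ` L" by (auto simp: S_def)
  have sub: "subspace S"
    unfolding SL using affine_diffs_subspace_subtract[OF assms(1,3)] by simp
  have dimS: "int (dim S) = int DIM('a) - int r"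
    using aff_dim_translation_eq_subtract[of p L] aff_dim_subspace[OF sub] assms(2) SL by simp
  let ?N = "{y \<in> UNIV. \<forall>x \<in> S. orthogonal x y}"
  have "dim ?N + dim S = dim (UNIV::'a set)"
    by (rule dim_subspace_orthogonal_to_vectors[OF sub]) auto
  then have dimN: "dim ?N = r" using dimS by simp
  have subN: "subspace ?N" using subspace_orthogonal_to_vectors[of S] by simp
  obtain B where B: "B \<subseteq> ?N" "pairwise orthogonal B" "\<And>x. x \<in> B \<Longrightarrow> norm x = 1"
     "independent B" "card B = dim ?N" "span B = ?N"
    by (rule orthonormal_basis_subspace[OF subN]) blast
  have "finite B" using B(4) by (rule independent_imp_finite)
  then obtain g where g: "bij_betw g {..<r} B"
    using bij_betw_from_nat_into_finite[of B] dimN B(5) by metis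
  define u where "u j = (if j < r then g j else 0)" for j
  have uB: "u ` {..<r} = B" using g by (auto simp: u_def bij_betw_def)
  have "u \<in> frames r"
    unfolding frames_def
  proof (intro CollectI conjI allI impI)
    have nu: "norm (u j) = 1" if "j < r" for j using B(3) uB that by blast
    then show "norm (u j) = 1" if "j < r" for j using that by blast
    show "norm (u j) \<le> 1" for j using nu[of j] by (cases "j < r") (auto simp: u_def)
    fix i j assume ij: "i < r" "j < r" "i \<noteq> j"
    then have "u i \<in> B" "u j \<in> B" using uB by blast+
    moreover have "u i \<noteq> u j"
      using g ij by (auto simp: u_def bij_betw_def inj_on_def)
    ultimately show "u i \<bullet> u j = 0" using B(2) by (simp add: pairwise_def orthogonal_def)
  qed
  moreover have "y \<in> L \<longleftrightarrow> (\<forall>j<r. u j \<bullet> (y - p) = 0)" for y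
  proof
    assume "y \<in> L"
    then have yS: "y - p \<in> S" by (auto simp: SL)
    show "\<forall>j<r. u j \<bullet> (y - p) = 0"
    proof (intro allI impI)
      fix j assume "j < r"
      then have "u j \<in> ?N" using uB B(1) by blast
      then have "orthogonal (y - p) (u j)" using yS by blast
      then show "u j \<bullet> (y - p) = 0" by (simp add: orthogonal_def inner_commute)
    qed
  next
    assume h: "\<forall>j<r. u j \<bullet> (y - p) = 0"
    have orthN: "orthogonal (y - p) w" if "w \<in> ?N" for w
    proof (rule orthogonal_to_span)
      show "w \<in> span B" using that B(6) by simp
      show "orthogonal (y - p) b" if "b \<in> B" for b
        using that h uB by (force simp: orthogonal_def inner_commute)
    qed
    \<comment> \<open>\<open>y - p\<close> is orthogonal to the complement \<open>?N\<close> of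
      \<open>S\<close>, so its component \<open>z\<close> in \<open>?N\<close> vanishes:
      \<open>S\<close> is its own double complement.\<close>
    obtain s z where sz: "s \<in> span S" "\<And>w. w \<in> span S \<Longrightarrow> orthogonal z w" "y - p = s + z"
      by (rule orthogonal_subspace_decomp_exists[of S "y - p"]) blast
    have "z \<in> ?N" using sz(2) by (auto simp: orthogonal_commute span_base)
    then have "orthogonal (s + z) z" using orthN sz(3) by simp
    moreover have "orthogonal s z" using sz(1,2) by (simp add: orthogonal_commute)
    ultimately have "z = 0" by (simp add: orthogonal_def inner_add_left)
    then have "y - p \<in> S" using sz(1,3) sub by (simp add: span_eq_iff[THEN iffD2, OF sub])
    then show "y \<in> L" by (auto simp: SL)
  qed
  ultimately show thesis using that[of u] by (simp add: set_eq_iff)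
qed

text \<open>Encoding: a pair \<open>(a, a)\<close> in \<open>P\<close> asks for the point \<open>x a\<close> itself to lie in the plane, a pair
  \<open>(a, b)\<close> only for the plane to meet the segment. Segments rather than lines keep the set closed.\<close>

definition incident :: "nat \<Rightarrow> ('i \<times> 'i) set \<Rightarrow> ('i \<Rightarrow> 'a::euclidean_space) set" where
  "incident r P = {x. \<exists>L. affine L \<and> aff_dim L = int DIM('a) - int r \<and>
                     (\<forall>e\<in>P. \<exists>q\<in>L. q \<in> closed_segment (x (fst e)) (x (snd e)))}"

text \<open>The set is the projection of a closed set along a compact factor, so the tube lemma
  makes its complement open. The factor is compact because no translation parameter occurs: the
  plane is anchored at its point on the segment \<open>e0\<close>, which is why \<open>P\<close>
  must be nonempty.\<close>

lemma closed_incident: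
  fixes P :: "('i \<times> 'i) set"
  assumes "P \<noteq> {}"
  shows "closed (incident r P :: ('i \<Rightarrow> 'a::euclidean_space) set)"
proof -
  obtain e0 where e0: "e0 \<in> P" using assms by blast
  define pt :: "('i \<Rightarrow> 'a) \<Rightarrow> ('i \<times> 'i \<Rightarrow> real) \<Rightarrow> 'i \<times> 'i \<Rightarrow> 'a" where
    "pt x t e = (1 - t e) *\<^sub>R x (fst e) + t e *\<^sub>R x (snd e)" for x t e
  define K :: "((nat \<Rightarrow> 'a) \<times> ('i \<times> 'i \<Rightarrow> real)) set" where
    "K = frames r \<times> {t. \<forall>e. t e \<in> {0..1}}"
  define C :: "(('i \<Rightarrow> 'a) \<times> ((nat \<Rightarrow> 'a) \<times> ('i \<times> 'i \<Rightarrow> real))) set" where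
    "C = {s. \<forall>e\<in>P. \<forall>j\<in>{..<r}. fst (snd s) j \<bullet> (pt (fst s) (snd (snd s)) e - pt (fst s) (snd (snd s)) e0) = 0}"
  have K: "compact K"
    unfolding K_def by (intro compact_Times compact_frames compact_UNIV_funcset) simp
  have cont: "continuous_on UNIV (\<lambda>s. fst (snd s) j \<bullet>
        (pt (fst s) (snd (snd s)) e - pt (fst s) (snd (snd s)) e0))" for j :: nat and e :: "'i \<times> 'i"
  proof -
    have 1: "continuous_on UNIV (\<lambda>s::(('i \<Rightarrow> 'a) \<times> ((nat \<Rightarrow> 'a) \<times> ('i \<times> 'i \<Rightarrow> real))). fst s i)" for i
      by (rule continuous_on_product_then_coordinatewise) (intro continuous_intros)
    have 2: "continuous_on UNIV (\<lambda>s::(('i \<Rightarrow> 'a) \<times> ((nat \<Rightarrow> 'a) \<times> ('i \<times> 'i \<Rightarrow> real))). fst (snd s) i)" for i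
      by (rule continuous_on_product_then_coordinatewise) (intro continuous_intros)
    have 3: "continuous_on UNIV (\<lambda>s::(('i \<Rightarrow> 'a) \<times> ((nat \<Rightarrow> 'a) \<times> ('i \<times> 'i \<Rightarrow> real))). snd (snd s) i)" for i
      by (rule continuous_on_product_then_coordinatewise) (intro continuous_intros)
    show ?thesis unfolding pt_def by (intro continuous_intros 1 2 3)
  qed
  have C: "closed C"
    unfolding C_def Ball_def
    by (intro closed_Collect_all closed_Collect_imp closed_Collect_eq cont
        open_Collect_const continuous_on_const)
  have iff: "x \<in> incident r P \<longleftrightarrow> (\<exists>k\<in>K. (x, k) \<in> C)" for x
  proof
    assume "x \<in> incident r P"
    then obtain L where L: "affine L" "aff_dim L = int DIM('a) - int r"
      and "\<forall>e\<in>P. \<exists>q\<in>L. q \<in> closed_segment (x (fst e)) (x (snd e))"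
      by (auto simp: incident_def)
    then have "\<forall>e\<in>P. \<exists>t. 0 \<le> t \<and> t \<le> 1 \<and> (1 - t) *\<^sub>R x (fst e) + t *\<^sub>R x (snd e) \<in> L"
      by (fastforce simp: in_segment)
    then obtain t0 where t0: "\<And>e. e \<in> P \<Longrightarrow> 0 \<le> t0 e \<and> t0 e \<le> 1 \<and> pt x t0 e \<in> L"
      unfolding pt_def by metis
    \<comment> \<open>The default 0 off \<open>P\<close> keeps every parameter in the unit interval,
      as \<open>K\<close> demands.\<close>
    define t where "t e = (if e \<in> P then t0 e else 0)" for e
    have t: "\<forall>e. t e \<in> {0..1}" "\<And>e. e \<in> P \<Longrightarrow> pt x t e \<in> L"
      using t0 by (auto simp: t_def pt_def)
    obtain u where u: "u \<in> frames r" "L = {y. \<forall>j<r. u j \<bullet> (y - pt x t e0) = 0}"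
      using affine_as_frame[OF L t(2)[OF e0]] .
    have "(u, t) \<in> K" using u t by (simp add: K_def)
    moreover have "(x, (u, t)) \<in> C" using u t by (auto simp: C_def)
    ultimately show "\<exists>k\<in>K. (x, k) \<in> C" by blast
  next
    assume "\<exists>k\<in>K. (x, k) \<in> C"
    then obtain u t where u: "u \<in> frames r" and t: "\<forall>e. t e \<in> {0..1}" and ut: "(x, (u, t)) \<in> C"
      by (auto simp: K_def)
    define S where "S = {z. \<forall>j<r. u j \<bullet> z = 0}"
    define L where "L = (+) (pt x t e0) ` S"
    have sub: "subspace S" by (auto simp: S_def subspace_def inner_add_right)
    have "affine L" unfolding L_def using subspace_imp_affine[OF sub] affine_translation by blast
    moreover have "aff_dim L = int DIM('a) - int r"
      unfolding L_def aff_dim_translation_eq aff_dim_subspace[OF sub]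
      using dim_orthogonal_frame[OF u] by (simp add: S_def)
    moreover have "\<exists>q\<in>L. q \<in> closed_segment (x (fst e)) (x (snd e))" if "e \<in> P" for e
    proof
      have "pt x t e - pt x t e0 \<in> S" using ut that by (auto simp: C_def S_def)
      then show "pt x t e \<in> L" unfolding L_def by (metis add_diff_cancel_left' diff_add_cancel add.commute image_eqI)
      show "pt x t e \<in> closed_segment (x (fst e)) (x (snd e))"
        unfolding in_segment pt_def using t by (intro exI[of _ "t e"]) (metis atLeastAtMost_iff)
    qed
    ultimately show "x \<in> incident r P" unfolding incident_def mem_Collect_eq by blast
  qed
  have "open (- incident r P :: ('i \<Rightarrow> 'a) set)"
  proof (subst open_subopen, intro ballI)
    fix x :: "'i \<Rightarrow> 'a" assume "x \<in> - incident r P"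
    then have "{x} \<times> K \<subseteq> - C" using iff by auto
    from Elementary_Topology.tube_lemma[OF K _ this] C obtain X where X: "x \<in> X" "open X" "X \<times> K \<subseteq> - C"
      by (auto simp: open_Compl)
    then have "X \<subseteq> - incident r P" using iff by blast
    then show "\<exists>T. open T \<and> x \<in> T \<and> T \<subseteq> - incident r P" using X by blast
  qed
  then show ?thesis by (simp add: closed_def)
qed

section \<open>General position\<close>

lemma aff_dim_Un_le_card:
  fixes S T :: "'a::euclidean_space set"
  assumes "finite T"
  shows "aff_dim (S \<union> T) \<le> aff_dim S + int (card T)"
  using assms
proof induction
  case (insert a T)
  have "aff_dim (S \<union> insert a T) \<le> aff_dim (S \<union> T) + 1"
    using aff_dim_insert[of a "S \<union> T"] by simp
  then show ?case using insert by simp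
qed simp

text \<open>Both endpoints lie in the affine hull of \<open>p\<close> and one further point, so
  trading \<open>p\<close> for them costs a single dimension.\<close>

lemma aff_dim_insert_segment:
  fixes a b p :: "'a::euclidean_space"
  assumes "p \<in> closed_segment a b"
  shows "aff_dim (insert a (insert b S)) \<le> aff_dim (insert p S) + 1"
proof -
  have "\<exists>c. {a, b} \<subseteq> affine hull {p, c}"
  proof (cases "p = a")
    case True
    then show ?thesis using hull_subset[of "{p, b}" affine] by blast
  next
    case False
    obtain t where t: "p = (1 - t) *\<^sub>R a + t *\<^sub>R b" using assms by (auto simp: in_segment)
    then have "t \<noteq> 0" using False by auto
    then have "a + (1 / t) *\<^sub>R (p - a) = b"
      unfolding t by (simp add: algebra_simps)
    then have "b = (1 / t) *\<^sub>R p + (1 - 1 / t) *\<^sub>R a" by (simp add: algebra_simps)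
    then have "b \<in> affine hull {p, a}"
      unfolding affine_hull_2 by (intro CollectI exI[of _ "1/t"] exI[of _ "1 - 1/t"]) simp
    then show ?thesis using hull_subset[of "{p, a}" affine] by blast
  qed
  then obtain c where c: "{a, b} \<subseteq> affine hull {p, c}" by blast
  have "{a, b} \<subseteq> affine hull (insert c (insert p S))"
    using c hull_mono[of "{p, c}" "insert c (insert p S)" affine] by blast
  moreover have "S \<subseteq> affine hull (insert c (insert p S))"
    by (meson hull_subset insert_subset order_trans subset_insertI)
  ultimately have "insert a (insert b S) \<subseteq> affine hull (insert c (insert p S))" by simp
  then have "aff_dim (insert a (insert b S)) \<le> aff_dim (insert c (insert p S))"
    using aff_dim_subset by (metis aff_dim_affine_hull)
  also have "\<dots> \<le> aff_dim (insert p S) + 1" by (simp add: aff_dim_insert)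
  finally show ?thesis .
qed

lemma affine_meets_line_unique:
  fixes a b :: "'a::real_vector"
  assumes "affine H" "a \<notin> H" "q \<in> affine hull {a, b}" "q' \<in> affine hull {a, b}" "q \<in> H" "q' \<in> H"
  shows "q = q'"
proof (rule ccontr)
  assume ne: "q \<noteq> q'"
  obtain s s' where s: "q = a + s *\<^sub>R (b - a)" "q' = a + s' *\<^sub>R (b - a)"
    using assms(3,4) unfolding affine_hull_2_alt by auto
  then have d: "s' - s \<noteq> 0" using ne by auto
  \<comment> \<open>The weights cancel the parameters \<open>s\<close> and \<open>s'\<close>, so
    this combination of \<open>q\<close> and \<open>q'\<close> is \<open>a\<close> itself.\<close>
  have eq: "(s' / (s' - s)) *\<^sub>R q + (- s / (s' - s)) *\<^sub>R q' \<in> H"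
  proof (rule mem_affine[OF assms(1,5,6)])
    show "s' / (s' - s) + - s / (s' - s) = 1" using d by (simp flip: diff_divide_distrib)
  qed
  have "(s' - s) *\<^sub>R ((s' / (s' - s)) *\<^sub>R q + (- s / (s' - s)) *\<^sub>R q') = s' *\<^sub>R q - s *\<^sub>R q'"
    using d by (simp add: scaleR_diff_right)
  also have "\<dots> = (s' - s) *\<^sub>R a" by (simp add: s algebra_simps)
  finally have "(s' / (s' - s)) *\<^sub>R q + (- s / (s' - s)) *\<^sub>R q' = a" using d by simp
  then show False using eq assms(2) by simp
qed

text \<open>The positions of the \<open>i\<close>-th point allowed by \<open>U\<close> form a
  nonempty open set, whereas a proper affine subspace has empty interior.\<close>

lemma perturb_coordinate:
  fixes U :: "('i \<Rightarrow> 'a::euclidean_space) set"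
  assumes "open U" "x \<in> U" "aff_dim A < int DIM('a)"
  obtains w where "x(i := w) \<in> U" "w \<notin> affine hull A"
proof -
  have "continuous_on UNIV (\<lambda>w. (x(i := w)) j)" for j
    by (cases "j = i") (auto intro: continuous_intros)
  then have "continuous_on UNIV (\<lambda>w. x(i := w))"
    by (rule continuous_on_coordinatewise_then_product)
  then have "open ((\<lambda>w. x(i := w)) -` U)"
    using assms(1) by (metis open_vimage)
  moreover have "x i \<in> (\<lambda>w. x(i := w)) -` U" using assms(2) by simp
  moreover have "interior (affine hull A) = {}"
    by (rule low_dim_interior) (use assms(3) in simp)
  ultimately have "\<not> (\<lambda>w. x(i := w)) -` U \<subseteq> affine hull A"
    by (metis empty_iff interior_maximal subsetD)
  then show thesis using that by blast
qed

lemma finite_Inter_open_dense: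
  assumes "finite \<G>" "\<And>G. G \<in> \<G> \<Longrightarrow> open G"
    and "\<And>G U. G \<in> \<G> \<Longrightarrow> open U \<Longrightarrow> U \<noteq> {} \<Longrightarrow> U \<inter> G \<noteq> {}"
    and "open U" "U \<noteq> {}"
  shows "U \<inter> \<Inter>\<G> \<noteq> {}"
  using assms
proof (induction arbitrary: U rule: finite_induct)
  case (insert G \<G>)
  have "open (U \<inter> G)" "U \<inter> G \<noteq> {}" using insert.prems by auto
  moreover have "\<And>H. H \<in> \<G> \<Longrightarrow> open H" "\<And>H V. H \<in> \<G> \<Longrightarrow> open V \<Longrightarrow> V \<noteq> {} \<Longrightarrow> V \<inter> H \<noteq> {}"
    using insert.prems(1,2) by (metis insertI2)+
  ultimately have "(U \<inter> G) \<inter> \<Inter>\<G> \<noteq> {}" by (rule insert.IH[rotated 2])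
  then show ?case by (simp add: Int_assoc)
qed simp

lemma dense_affinely_independent:
  fixes U :: "('i \<Rightarrow> 'a::euclidean_space) set"
  assumes "finite I" "card I \<le> DIM('a) + 1" "open U" "U \<noteq> {}"
  shows "\<exists>x\<in>U. aff_dim (x ` I) = int (card I) - 1"
  using assms
proof (induction arbitrary: U rule: finite_induct)
  case empty
  then show ?case by auto
next
  case (insert i J)
  then obtain x where x: "x \<in> U" "aff_dim (x ` J) = int (card J) - 1" by auto
  then have "aff_dim (x ` J) < int DIM('a)" using insert by simp
  then obtain w where w: "x(i := w) \<in> U" "w \<notin> affine hull (x ` J)"
    using perturb_coordinate[OF insert.prems(2) x(1)] by blast
  have "x(i := w) ` insert i J = insert w (x ` J)" using insert.hyps by auto
  then have "aff_dim (x(i := w) ` insert i J) = int (card (insert i J)) - 1"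
    using w(2) x(2) insert.hyps by (simp add: aff_dim_insert)
  then show ?case using w(1) by blast
qed

text \<open>Index sets instead of point sets, so that coinciding points are excluded as well.
  Smaller index sets are covered by extension once \<open>N\<close> has \<open>DIM('a) + 1\<close>
  elements.\<close>

definition general_tuples :: "'i set \<Rightarrow> ('i \<Rightarrow> 'a::euclidean_space) set" where
  "general_tuples N = {x. \<forall>I\<subseteq>N. card I = DIM('a) + 1 \<longrightarrow> aff_dim (x ` I) = int DIM('a)}"

text \<open>Degenerate position is itself an incidence, of points with a hyperplane. Hence openness
  of general position is another instance of \<open>closed_incident\<close>.\<close>

lemma incident_diagonal_iff:
  fixes x :: "'i \<Rightarrow> 'a::euclidean_space"
  shows "x \<in> incident 1 ((\<lambda>i. (i, i)) ` I) \<longleftrightarrow> aff_dim (x ` I) < int DIM('a)"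
proof
  assume "x \<in> incident 1 ((\<lambda>i. (i, i)) ` I)"
  then obtain L where "aff_dim L = int DIM('a) - 1" "x ` I \<subseteq> L"
    by (auto simp: incident_def)
  then show "aff_dim (x ` I) < int DIM('a)" using aff_dim_subset[of "x ` I" L] by linarith
next
  assume "aff_dim (x ` I) < int DIM('a)"
  then obtain a b where "a \<noteq> 0" "x ` I \<subseteq> {y. a \<bullet> y = b}"
    by (rule aff_lowdim_subset_hyperplane)
  moreover from this have "affine {y. a \<bullet> y = b}" "aff_dim {y. a \<bullet> y = b} = int DIM('a) - 1"
    by (auto simp: affine_hyperplane)
  ultimately show "x \<in> incident 1 ((\<lambda>i. (i, i)) ` I)"
    unfolding incident_def by (intro CollectI exI[of _ "{y. a \<bullet> y = b}"]) auto
qed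

lemma general_tuples_eq:
  "(general_tuples N :: ('i \<Rightarrow> 'a::euclidean_space) set) =
     \<Inter>((\<lambda>I. - incident 1 ((\<lambda>i. (i, i)) ` I)) ` {I. I \<subseteq> N \<and> card I = DIM('a) + 1})"
proof -
  have "aff_dim (x ` I) = int DIM('a) \<longleftrightarrow> \<not> aff_dim (x ` I) < int DIM('a)" for x :: "'i \<Rightarrow> 'a" and I
    using aff_dim_le_DIM[of "x ` I"] by linarith
  then show ?thesis by (auto simp only: general_tuples_def incident_diagonal_iff)
qed

lemma open_incident_diagonal:
  fixes I :: "'i set"
  assumes "card I = DIM('a::euclidean_space) + 1"
  shows "open (- incident 1 ((\<lambda>i. (i, i)) ` I) :: ('i \<Rightarrow> 'a) set)"
proof -
  have "I \<noteq> {}" using assms by auto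
  then show ?thesis using closed_incident[of "(\<lambda>i. (i, i)) ` I" 1] unfolding open_closed by simp
qed

lemma open_general_tuples:
  assumes "finite N"
  shows "open (general_tuples N :: ('i \<Rightarrow> 'a::euclidean_space) set)"
  unfolding general_tuples_eq
  using assms by (intro open_Inter finite_imageI) (auto simp del: One_nat_def intro: open_incident_diagonal)

lemma dense_general_tuples:
  fixes U :: "('i \<Rightarrow> 'a::euclidean_space) set"
  assumes "finite N" "open U" "U \<noteq> {}"
  shows "U \<inter> general_tuples N \<noteq> {}"
  unfolding general_tuples_eq
proof (rule finite_Inter_open_dense[OF _ _ _ assms(2,3)])
  fix G V :: "('i \<Rightarrow> 'a) set"
  assume G: "G \<in> (\<lambda>I. - incident 1 ((\<lambda>i. (i, i)) ` I)) ` {I. I \<subseteq> N \<and> card I = DIM('a) + 1}"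
  then obtain I where I: "G = - incident 1 ((\<lambda>i. (i, i)) ` I)" "I \<subseteq> N" "card I = DIM('a) + 1"
    by blast
  show "open G" unfolding I(1) by (rule open_incident_diagonal[OF I(3)])
  assume V: "open V" "V \<noteq> {}"
  obtain x where "x \<in> V" "aff_dim (x ` I) = int (card I) - 1"
    using dense_affinely_independent[OF finite_subset[OF I(2) assms(1)] _ V] I(3) by (metis order_refl)
  then have "x \<in> V \<inter> G" using I incident_diagonal_iff[of x I] by simp
  then show "V \<inter> G \<noteq> {}" by blast
qed (use assms(1) in simp)

text \<open>Each added point raises the dimension by at most one, so a deficient index set could not
  be extended to \<open>DIM('a) + 1\<close> indices of full dimension.\<close>

lemma general_tuples_aff_dim:
  fixes x :: "'i \<Rightarrow> 'a::euclidean_space"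
  assumes "x \<in> general_tuples N" "finite N" "DIM('a) + 1 \<le> card N" "I \<subseteq> N" "card I \<le> DIM('a) + 1"
  shows "aff_dim (x ` I) = int (card I) - 1"
proof -
  have fI: "finite I" using assms finite_subset by blast
  obtain J where J: "I \<subseteq> J" "J \<subseteq> N" "card J = DIM('a) + 1"
    using exists_subset_between[of I "DIM('a) + 1" N] assms by metis
  then have fJ: "finite J" using assms finite_subset by blast
  have "int DIM('a) = aff_dim (x ` J)" using assms(1) J by (simp add: general_tuples_def)
  moreover have "aff_dim (x ` J) \<le> aff_dim (x ` I) + int (card (x ` (J - I)))"
    using aff_dim_Un_le_card[of "x ` (J - I)" "x ` I"] fJ J(1)
    by (simp add: Un_absorb1 flip: image_Un)
  moreover have "card (x ` (J - I)) \<le> card (J - I)" using fJ by (simp add: card_image_le)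
  moreover have "card (J - I) = DIM('a) + 1 - card I"
    by (simp only: card_Diff_subset[OF fI J(1)] J(3))
  ultimately have "int (card I) - 1 \<le> aff_dim (x ` I)" using assms(5) by linarith
  moreover have "aff_dim (x ` I) \<le> int (card (x ` I)) - 1" 
    using fI by (intro aff_dim_le_card) simp
  ultimately show ?thesis using card_image_le[OF fI, of x] by linarith
qed

lemma general_tuples_card_affine:
  fixes x :: "'i \<Rightarrow> 'a::euclidean_space"
  assumes "x \<in> general_tuples N" "finite N" "DIM('a) + 1 \<le> card N"
    and "aff_dim A \<le> int f" "f < DIM('a)"
  shows "card {i \<in> N. x i \<in> A} \<le> f + 1"
proof (rule ccontr)
  assume "\<not> ?thesis"
  then obtain I where I: "I \<subseteq> {i \<in> N. x i \<in> A}" "card I = f + 2"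
    by (metis Suc_eq_plus1 add_2_eq_Suc' not_less_eq_eq obtain_subset_with_card_n)
  have "aff_dim (x ` I) = int (card I) - 1"
    using I assms by (intro general_tuples_aff_dim[of x N]) auto
  moreover have "aff_dim (x ` I) \<le> aff_dim A" using I by (intro aff_dim_subset) auto
  ultimately show False using I assms(4) by simp
qed

lemma general_tuples_inj:
  fixes x :: "'i \<Rightarrow> 'a::euclidean_space"
  assumes "x \<in> general_tuples N" "finite N" "DIM('a) + 1 \<le> card N"
  shows "inj_on x N"
proof (rule inj_onI, rule ccontr)
  fix i j assume ij: "i \<in> N" "j \<in> N" "x i = x j" "i \<noteq> j"
  have "aff_dim (x ` {i, j}) = int (card {i, j}) - 1"
    using ij DIM_positive[where 'a='a] by (intro general_tuples_aff_dim[OF assms]) (auto simp: Suc_le_eq)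
  then show False using ij by simp
qed

lemma general_tuples_general_position:
  fixes x :: "'i \<Rightarrow> 'a::euclidean_space"
  assumes "x \<in> general_tuples N" "finite N" "DIM('a) + 1 \<le> card N"
  shows "general_position (x ` N)"
  unfolding general_position_def
proof (intro allI impI)
  fix S assume S: "S \<subseteq> x ` N" "finite S \<and> card S \<le> DIM('a) + 1"
  obtain I where I: "I \<subseteq> N" "S = x ` I" using S(1) by (meson subset_imageE)
  have "card S = card I"
    using I general_tuples_inj[OF assms] by (simp add: card_image inj_on_subset)
  then have "aff_dim S = int (card S) - 1"
    using general_tuples_aff_dim[OF assms I(1)] I S by simp
  then show "\<not> affine_dependent S" using S by (simp add: affine_independent_iff_card)
qed

section \<open>Generic tuples\<close>

definition endpoints :: "('i \<times> 'i) set \<Rightarrow> 'i set" where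
  "endpoints Q = fst ` Q \<union> snd ` Q"

definition proper :: "('i \<times> 'i) set \<Rightarrow> ('i \<times> 'i) set" where
  "proper Q = {e \<in> Q. fst e \<noteq> snd e}"

text \<open>The last clause admits diagonal pairs, while distinct pairs share no endpoint in either
  role.\<close>

definition disjoint_pairs :: "('i \<times> 'i) set \<Rightarrow> bool" where
  "disjoint_pairs P \<longleftrightarrow> inj_on fst P \<and> inj_on snd P \<and> (\<forall>e\<in>P. \<forall>f\<in>P. fst e = snd f \<longrightarrow> e = f)"

lemma card_endpoints:
  assumes "disjoint_pairs P" "Q \<subseteq> P" "finite P"
  shows "card (endpoints Q) = card Q + card (proper Q)"
proof -
  have fin: "finite Q" "finite (proper Q)"
    using finite_subset[OF assms(2,3)] by (simp_all add: proper_def)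
  have inj: "inj_on fst Q" "inj_on snd (proper Q)"
    using assms(1,2) inj_on_subset[of fst P Q] inj_on_subset[of snd P "proper Q"]
    by (auto simp: disjoint_pairs_def proper_def)
  have "endpoints Q = fst ` Q \<union> snd ` proper Q"
  proof
    show "endpoints Q \<subseteq> fst ` Q \<union> snd ` proper Q"
    proof
      fix i assume "i \<in> endpoints Q"
      then obtain e where e: "e \<in> Q" "i = fst e \<or> i = snd e" by (auto simp: endpoints_def)
      show "i \<in> fst ` Q \<union> snd ` proper Q"
      proof (cases "i = fst e")
        case False
        then have "e \<in> proper Q" "i = snd e" using e by (auto simp: proper_def)
        then show ?thesis by blast
      qed (use e in blast)
    qed
  qed (auto simp: endpoints_def proper_def)
  moreover have "fst ` Q \<inter> snd ` proper Q = {}"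
  proof (rule ccontr)
    assume "fst ` Q \<inter> snd ` proper Q \<noteq> {}"
    then obtain i where "i \<in> fst ` Q" "i \<in> snd ` proper Q" by blast
    then obtain e f where ef: "e \<in> Q" "f \<in> proper Q" "fst e = snd f" by (elim imageE) simp
    then have "e = f" using assms(1,2) unfolding disjoint_pairs_def proper_def by blast
    then show False using ef by (simp add: proper_def)
  qed
  ultimately show ?thesis
    using fin inj by (simp add: card_Un_disjoint card_image)
qed

lemma endpoint_eq_iff:
  assumes "disjoint_pairs P" "e \<in> P" "f \<in> P" "i \<in> {fst e, snd e}" "i \<in> {fst f, snd f}"
  shows "e = f"
proof -
  consider "fst e = fst f" | "snd e = snd f" | "fst e = snd f" | "fst f = snd e"
    using assms(4,5) by auto
  then show ?thesis
    by cases (use assms(1-3) in \<open>unfold disjoint_pairs_def inj_on_def, blast+\<close>)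
qed

text \<open>Each proper pair costs one dimension by \<open>aff_dim_insert_segment\<close>, a
  diagonal pair none. The set \<open>A\<close> absorbs the endpoints already exchanged during the
  induction.\<close>

lemma aff_dim_endpoints_le:
  fixes x :: "'i \<Rightarrow> 'a::euclidean_space"
  assumes "finite Q" "\<And>e. e \<in> Q \<Longrightarrow> p e \<in> closed_segment (x (fst e)) (x (snd e))"
  shows "aff_dim (A \<union> x ` endpoints Q) \<le> aff_dim (A \<union> p ` Q) + int (card (proper Q))"
  using assms
proof (induction arbitrary: A rule: finite_induct)
  case empty
  then show ?case by (simp add: endpoints_def)
next
  case (insert e Q)
  let ?A = "insert (x (fst e)) (insert (x (snd e)) A)"
  have "A \<union> x ` endpoints (insert e Q) = ?A \<union> x ` endpoints Q"
    by (auto simp: endpoints_def)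
  moreover have "aff_dim (?A \<union> x ` endpoints Q) \<le> aff_dim (?A \<union> p ` Q) + int (card (proper Q))"
    using insert.prems by (intro insert.IH) auto
  moreover have "aff_dim (?A \<union> p ` Q) + int (card (proper Q))
      \<le> aff_dim (A \<union> p ` insert e Q) + int (card (proper (insert e Q)))"
  proof (cases "fst e = snd e")
    case True
    then have "p e = x (fst e)" using insert.prems[of e] by simp
    then have "?A \<union> p ` Q = A \<union> p ` insert e Q" using True by auto
    moreover have "proper (insert e Q) = proper Q" using True by (auto simp: proper_def)
    ultimately show ?thesis by simp
  next
    case False
    then have "proper (insert e Q) = insert e (proper Q)" "e \<notin> proper Q" "finite (proper Q)"
      using insert.hyps by (auto simp: proper_def)
    then have "card (proper (insert e Q)) = card (proper Q) + 1" by simp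
    moreover have "aff_dim (?A \<union> p ` Q) \<le> aff_dim (A \<union> p ` insert e Q) + 1"
      using aff_dim_insert_segment[OF insert.prems[of e], of "A \<union> p ` Q"] by simp
    ultimately show ?thesis by simp
  qed
  ultimately show ?case by simp
qed

text \<open>In a pattern the \<open>d + 2 - 2 l\<close> diagonal pairs stand for points on a \<open>(d - l)\<close>-plane and the
  \<open>l + 1\<close> proper pairs for segments met by it; the cardinality is \<open>card P = d + 3 - l\<close>, written
  without subtraction.\<close>

definition patterns :: "nat \<Rightarrow> nat \<Rightarrow> 'i set \<Rightarrow> ('i \<times> 'i) set set" where
  "patterns d l N = {P. P \<subseteq> N \<times> N \<and> disjoint_pairs P \<and> card (proper P) = l + 1 \<and> card P + l = d + 3}"

text \<open>Starting from a tuple in general position, move only the endpoint \<open>snd e\<close>. The segments other than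
  \<open>e\<close> and \<open>e1\<close> span with the points a hyperplane \<open>H\<close> containing any incident plane, so that plane
  meets the segment \<open>e1\<close> in a point \<open>q\<close> not depending on \<open>snd e\<close>. Leaving out \<open>e\<close> and \<open>e3\<close> instead
  puts the new endpoint into the affine hull of a fixed set \<open>B\<close> of \<open>d\<close> points.\<close>

lemma dense_not_incident:
  fixes U :: "('i \<Rightarrow> 'a::euclidean_space) set"
  assumes N: "finite N" "DIM('a) + 1 \<le> card N"
    and l: "2 \<le> l" "l \<le> DIM('a)"
    and P: "P \<in> patterns DIM('a) l N"
    and U: "open U" "U \<noteq> {}"
  shows "U \<inter> - incident l P \<noteq> {}"
proof -
  have PN: "P \<subseteq> N \<times> N" and dis: "disjoint_pairs P" and cO: "card (proper P) = l + 1"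
    and cP: "card P + l = DIM('a) + 3"
    using P by (auto simp: patterns_def)
  have fP: "finite P" using PN N(1) by (meson finite_SigmaI finite_subset)
  define U' where "U' = U \<inter> general_tuples N"
  have U': "open U'" "U' \<noteq> {}"
    using U open_general_tuples[OF N(1)] dense_general_tuples[OF N(1) U] by (auto simp: U'_def)
  then obtain x0 where x0: "x0 \<in> U'" by blast
  \<comment> \<open>Three segments are needed, hence \<open>l \<ge> 2\<close>: \<open>e\<close> is
    moved, \<open>e1\<close> yields the fixed point \<open>q\<close>, and \<open>e3\<close> is left
    out at the end.\<close>
  obtain T where T: "T \<subseteq> proper P" "card T = 3"
    using cO l(1) obtain_subset_with_card_n[of 3 "proper P"] by auto
  then obtain e e1 e3 where T3: "T = {e, e1, e3}" "e \<noteq> e1" "e1 \<noteq> e3" "e \<noteq> e3"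
    by (auto simp: card_3_iff)
  then have eO: "e \<in> proper P" "e1 \<in> proper P" "e3 \<in> proper P" using T by auto
  then have eP: "e \<in> P" "e1 \<in> P" "e3 \<in> P" by (auto simp: proper_def)
  have prop_diff: "proper (P - S) = proper P - S" for S by (auto simp: proper_def)
  \<comment> \<open>Of the remaining \<open>d + 1 - l\<close> pairs, \<open>l - 1\<close> are
    proper, which makes \<open>d\<close> endpoints: in general position they span a
    hyperplane.\<close>
  have card_R: "card (endpoints (P - {a, b})) = DIM('a)" "card (proper (P - {a, b})) = l - 1"
    if "a \<in> proper P" "b \<in> proper P" "a \<noteq> b" for a b
  proof -
    have ab: "{a, b} \<subseteq> P" "{a, b} \<subseteq> proper P" using that by (auto simp: proper_def)
    have "card (P - {a, b}) = card P - 2" "card (proper P - {a, b}) = card (proper P) - 2"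
      using ab that(3) by (simp_all add: card_Diff_subset)
    moreover have "card (endpoints (P - {a, b})) = card (P - {a, b}) + card (proper (P - {a, b}))"
      by (rule card_endpoints[OF dis _ fP]) auto
    ultimately show "card (endpoints (P - {a, b})) = DIM('a)" "card (proper (P - {a, b})) = l - 1"
      using cO cP l by (simp_all add: prop_diff)
  qed
  have card_Q: "card (endpoints (P - {e, e1, e3})) = DIM('a) - 2"
  proof -
    have ab: "{e, e1, e3} \<subseteq> P" "{e, e1, e3} \<subseteq> proper P" using eP eO by auto
    have "card (P - {e, e1, e3}) = card P - 3" "card (proper P - {e, e1, e3}) = card (proper P) - 3"
      using ab T3 by (simp_all add: card_Diff_subset)
    moreover have "card (endpoints (P - {e, e1, e3})) = card (P - {e, e1, e3}) + card (proper (P - {e, e1, e3}))"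
      by (rule card_endpoints[OF dis _ fP]) auto
    ultimately show ?thesis
      using cO cP l by (simp add: prop_diff)
  qed
  have fE: "finite (endpoints Q)" if "Q \<subseteq> P" for Q
    using that fP finite_subset by (auto simp: endpoints_def)
  have EN: "endpoints Q \<subseteq> N" if "Q \<subseteq> P" for Q
    using that PN by (auto simp: endpoints_def)
  define R where "R = P - {e, e1}"
  define H where "H = affine hull (x0 ` endpoints R)"
  \<comment> \<open>\<open>q\<close> depends on \<open>x0\<close> only, so that \<open>w\<close> can
    be chosen afterwards. That such a point exists and is unique is derived later, from the assumed
    incidence.\<close>
  define q where "q = (SOME q. q \<in> affine hull {x0 (fst e1), x0 (snd e1)} \<and> q \<in> H)"
  define B where "B = insert q (insert (x0 (fst e)) (x0 ` endpoints (P - {e, e1, e3})))"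
  have "aff_dim (x0 ` endpoints (P - {e, e1, e3})) \<le> int (card (x0 ` endpoints (P - {e, e1, e3}))) - 1"
    by (intro aff_dim_le_card finite_imageI fE) auto
  also have "\<dots> \<le> int (DIM('a) - 2) - 1"
    using card_image_le[OF fE[of "P - {e, e1, e3}"], of x0] card_Q by auto
  finally have "aff_dim B < int DIM('a)"
    using l unfolding B_def by (simp add: aff_dim_insert of_nat_diff)
  then obtain w where w: "x0(snd e := w) \<in> U'" "w \<notin> affine hull B"
    using perturb_coordinate[OF U'(1) x0] by blast
  define x where "x = x0(snd e := w)"
  have gt: "x \<in> general_tuples N" using w by (simp add: x_def U'_def)
  have agree: "x i = x0 i" if "i \<in> endpoints (P - {e})" for i
    using that endpoint_eq_iff[OF dis eP(1)] by (fastforce simp: x_def endpoints_def)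
  have "fst e \<noteq> snd e" using eO by (simp add: proper_def)
  then have xe: "x (fst e) = x0 (fst e)" "x (snd e) = w" by (simp_all add: x_def)
  have imR: "x ` endpoints Q = x0 ` endpoints Q" if "Q \<subseteq> P - {e}" for Q
    using that agree by (intro image_cong) (auto simp: endpoints_def)
  have "x \<notin> incident l P"
  proof
    assume "x \<in> incident l P"
    then obtain L where L: "affine L" "aff_dim L = int DIM('a) - int l"
      and "\<forall>f\<in>P. \<exists>q\<in>L. q \<in> closed_segment (x (fst f)) (x (snd f))"
      by (auto simp: incident_def)
    then obtain p where p: "\<And>f. f \<in> P \<Longrightarrow> p f \<in> L"
      "\<And>f. f \<in> P \<Longrightarrow> p f \<in> closed_segment (x (fst f)) (x (snd f))" by metis
    have p_hull: "p f \<in> affine hull {x (fst f), x (snd f)}" if "f \<in> P" for f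
      using p(2)[OF that] convex_hull_subset_affine_hull by (auto simp: segment_convex_hull)
    \<comment> \<open>The endpoints have dimension \<open>d - 1\<close> and the \<open>l - 1\<close>
      proper pairs account for at most \<open>l - 1\<close> of it, so the remaining points
      \<open>p f\<close> already span the whole \<open>(d - l)\<close>-plane.\<close>
    have span: "affine hull (p ` (P - {a, b})) = L"
      if "a \<in> proper P" "b \<in> proper P" "a \<noteq> b" for a b
    proof -
      let ?Q = "P - {a, b}"
      have "aff_dim (x ` endpoints ?Q) = int DIM('a) - 1"
        using card_R(1)[OF that] EN[of ?Q] by (subst general_tuples_aff_dim[OF gt N]) auto
      moreover have "aff_dim (x ` endpoints ?Q) \<le> aff_dim (p ` ?Q) + int (card (proper ?Q))"
        using aff_dim_endpoints_le[of ?Q p x "{}"] fP p(2) by auto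
      ultimately have ge: "aff_dim (p ` ?Q) \<ge> int DIM('a) - int l"
        using card_R(2)[OF that] l by simp
      have sub: "affine hull (p ` ?Q) \<subseteq> L" using p(1) L(1) by (intro hull_minimal) auto
      then have "aff_dim (p ` ?Q) \<le> aff_dim L" by (metis aff_dim_affine_hull aff_dim_subset)
      then have "aff_dim (affine hull (p ` ?Q)) = aff_dim L" using ge L(2) by simp
      moreover have "p ` ?Q \<noteq> {}"
      proof
        assume eq: "p ` ?Q = {}"
        have "aff_dim (p ` ?Q) = -1" unfolding eq by simp
        then show False using ge l by linarith
      qed
      ultimately show ?thesis using affine_dim_equal[OF affine_affine_hull L(1) _ sub] by simp
    qed
    have hull_endpoints: "p f \<in> affine hull (x ` endpoints Q)" if "f \<in> Q" "Q \<subseteq> P" for f Q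
    proof -
      have "affine hull {x (fst f), x (snd f)} \<subseteq> affine hull (x ` endpoints Q)"
        using that by (intro hull_mono) (auto simp: endpoints_def)
      then show ?thesis using p_hull that by blast
    qed
    have Hx: "H = affine hull (x ` endpoints R)"
      unfolding H_def by (subst imR) (auto simp: R_def)
    have RP: "R \<subseteq> P" by (auto simp: R_def)
    have LH: "L \<subseteq> H"
    proof -
      have "p ` R \<subseteq> H" unfolding Hx using hull_endpoints RP by blast
      then have "affine hull (p ` R) \<subseteq> H" unfolding H_def by (intro hull_minimal) auto
      then show ?thesis using span[OF eO(1,2) T3(2)] by (simp add: R_def)
    qed
    have not_H: "x (fst f) \<notin> H" if "f \<in> {e, e1}" for f
    proof
      assume "x (fst f) \<in> H"
      have fP: "f \<in> P" using that eP by blast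
      have "fst f \<notin> endpoints R"
        using endpoint_eq_iff[OF dis fP, of _ "fst f"] that by (fastforce simp: R_def endpoints_def)
      then have "card (insert (fst f) (endpoints R)) = DIM('a) + 1"
        using card_R(1)[OF eO(1,2) T3(2)] fE[OF RP] by (simp add: R_def)
      moreover have "insert (fst f) (endpoints R) \<subseteq> N" using EN[OF RP] fP PN by auto
      ultimately have "aff_dim (x ` insert (fst f) (endpoints R)) = int DIM('a)"
        using gt by (simp only: general_tuples_def mem_Collect_eq)
      moreover have "aff_dim (x ` insert (fst f) (endpoints R)) = aff_dim (x ` endpoints R)"
        using \<open>x (fst f) \<in> H\<close> by (simp add: aff_dim_insert Hx)
      moreover have "aff_dim (x ` endpoints R) = int DIM('a) - 1"
        using card_R(1)[OF eO(1,2) T3(2)] EN[OF RP]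
        by (subst general_tuples_aff_dim[OF gt N]) (auto simp: R_def)
      ultimately show False by simp
    qed
    have in1: "{fst e1, snd e1} \<subseteq> endpoints (P - {e})"
      using eP T3 by (auto simp: endpoints_def)
    then have x1: "x (fst e1) = x0 (fst e1)" "x (snd e1) = x0 (snd e1)" using agree by auto
    have pe1: "p e1 \<in> affine hull {x0 (fst e1), x0 (snd e1)} \<and> p e1 \<in> H"
      using p_hull[OF eP(2)] p(1)[OF eP(2)] LH x1 by auto
    then have "q \<in> affine hull {x0 (fst e1), x0 (snd e1)} \<and> q \<in> H"
      unfolding q_def by (rule someI)
    then have q: "p e1 = q"
      using affine_meets_line_unique[of H "x0 (fst e1)" "p e1" "x0 (snd e1)" q] pe1 not_H[of e1] x1
      by (simp add: H_def)
    have LB: "L \<subseteq> affine hull B"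
    proof -
      have "p f \<in> affine hull B" if "f \<in> P - {e, e3}" for f
      proof (cases "f = e1")
        case True
        then show ?thesis using q by (simp add: B_def hull_inc)
      next
        case False
        have "p f \<in> affine hull (x ` endpoints (P - {e, e1, e3}))"
          using False that by (intro hull_endpoints) auto
        also have "x ` endpoints (P - {e, e1, e3}) = x0 ` endpoints (P - {e, e1, e3})"
          by (rule imR) auto
        also have "affine hull \<dots> \<subseteq> affine hull B" unfolding B_def by (intro hull_mono) auto
        finally show ?thesis .
      qed
      then have "affine hull (p ` (P - {e, e3})) \<subseteq> affine hull B"
        by (intro hull_minimal) auto
      then show ?thesis using span[OF eO(1,3) T3(4)] by simp
    qed
    \<comment> \<open>This makes \<open>t\<close> nonzero, so \<open>w\<close> lies on the line
      through \<open>x (fst e)\<close> and \<open>p e\<close>, both in the hull of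
      \<open>B\<close>.\<close>
    have "p e \<noteq> x (fst e)" using not_H[of e] p(1)[OF eP(1)] LH by auto
    obtain t where t: "p e = (1 - t) *\<^sub>R x (fst e) + t *\<^sub>R w"
      using p(2)[OF eP(1)] xe by (auto simp: in_segment)
    have "t \<noteq> 0" using t \<open>p e \<noteq> x (fst e)\<close> by auto
    then have "w = (1 / t) *\<^sub>R p e + (1 - 1 / t) *\<^sub>R x (fst e)"
      unfolding t by (simp add: algebra_simps)
    moreover have "x (fst e) \<in> affine hull B" unfolding xe B_def by (intro hull_inc) auto
    moreover have "p e \<in> affine hull B" using LB p(1)[OF eP(1)] by blast
    ultimately have "w \<in> affine hull B"
      using mem_affine[OF affine_affine_hull, of "p e" B "x (fst e)" "1/t" "1 - 1/t"] by simp
    then show False using w(2) by blast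
  qed
  then show ?thesis using w(1) by (auto simp: x_def U'_def)
qed

lemma exists_generic_tuple:
  fixes x :: "'i \<Rightarrow> 'a::euclidean_space"
  assumes N: "finite N" "DIM('a) + 1 \<le> card N"
    and l: "2 \<le> l" "l \<le> DIM('a)" and "\<epsilon> > 0"
  obtains x' :: "'i \<Rightarrow> 'a" where "x' \<in> general_tuples N" "\<And>i. i \<in> N \<Longrightarrow> norm (x i - x' i) < \<epsilon>"
    "\<And>P. P \<in> patterns DIM('a) l N \<Longrightarrow> x' \<notin> incident l P"
proof -
  define U where "U = (\<Inter>i\<in>N. {y :: 'i \<Rightarrow> 'a. norm (x i - y i) < \<epsilon>})"
  have "open U"
    unfolding U_def using N(1)
    by (intro open_INT ballI open_Collect_less continuous_intros continuous_on_product_coordinates) auto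
  moreover have "x \<in> U" using \<open>\<epsilon> > 0\<close> by (simp add: U_def)
  moreover define \<G> where
    "\<G> = insert (general_tuples N) ((\<lambda>P. - incident l P :: ('i \<Rightarrow> 'a) set) ` patterns DIM('a) l N)"
  have "U \<inter> \<Inter>\<G> \<noteq> {}"
  proof (rule finite_Inter_open_dense)
    have "patterns DIM('a) l N \<subseteq> Pow (N \<times> N)" by (auto simp: patterns_def)
    then show "finite \<G>" using N(1) by (auto simp: \<G>_def intro: finite_subset)
    show "open G" if "G \<in> \<G>" for G
    proof (cases "G = general_tuples N")
      case False
      then obtain P where P: "P \<in> patterns DIM('a) l N" "G = - incident l P"
        using \<open>G \<in> \<G>\<close> by (auto simp: \<G>_def)
      then have "P \<noteq> {}" by (auto simp: patterns_def proper_def)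
      then show ?thesis unfolding P(2) using closed_incident by blast
    qed (simp add: open_general_tuples N)
    show "V \<inter> G \<noteq> {}" if "G \<in> \<G>" "open V" "V \<noteq> {}" for G V
      using that dense_general_tuples[OF N(1)] dense_not_incident[OF N l] unfolding \<G>_def by blast
  qed (use \<open>open U\<close> \<open>x \<in> U\<close> in auto)
  then obtain x' where "x' \<in> U" "x' \<in> general_tuples N"
    "\<And>P. P \<in> patterns DIM('a) l N \<Longrightarrow> x' \<notin> incident l P"
    unfolding \<G>_def by blast
  then show thesis using that[of x'] by (simp add: U_def)
qed

section \<open>Vectors with few elements in every open half-space\<close>

text \<open>Each new vector is handled by adding a multiple of its component \<open>z\<close>
  orthogonal to \<open>F\<close>; only finitely many multiples are bad.\<close>

lemma generic_functional:
  fixes v :: "'i \<Rightarrow> 'a::euclidean_space"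
  assumes "finite J" "subspace F" "\<And>i. i \<in> J \<Longrightarrow> v i \<notin> F"
  obtains u where "\<And>y. y \<in> F \<Longrightarrow> u \<bullet> y = 0" "\<And>i. i \<in> J \<Longrightarrow> u \<bullet> v i \<noteq> 0"
proof -
  have "\<exists>u. (\<forall>y\<in>F. u \<bullet> y = 0) \<and> (\<forall>i\<in>J. u \<bullet> v i \<noteq> 0)"
    using assms(1,3)
  proof (induction rule: finite_induct)
    case empty
    show ?case by (intro exI[of _ 0]) simp
  next
    case (insert i J)
    then obtain u where u: "\<forall>y\<in>F. u \<bullet> y = 0" "\<forall>i\<in>J. u \<bullet> v i \<noteq> 0" by auto
    have spF: "span F = F" using assms(2) by (simp add: span_eq_iff)
    obtain y z where yz: "y \<in> F" "\<And>w. w \<in> F \<Longrightarrow> orthogonal z w" "v i = y + z"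
      using orthogonal_subspace_decomp_exists[of F "v i"] unfolding spF by metis
    have "z \<noteq> 0" using yz insert.prems[of i] by auto
    moreover have "z \<bullet> y = 0" using yz(1,2) by (simp add: orthogonal_def)
    ultimately have zi: "z \<bullet> v i \<noteq> 0" by (simp add: yz(3) inner_add_right)
    \<comment> \<open>A vector with \<open>z \<bullet> v j = 0\<close> is unaffected by
      \<open>t\<close>; it is not the new one, so \<open>u\<close> already serves it.\<close>
    have "finite ((\<lambda>j. - (u \<bullet> v j) / (z \<bullet> v j)) ` insert i J)" using insert.hyps by simp
    then obtain t where t: "t \<notin> (\<lambda>j. - (u \<bullet> v j) / (z \<bullet> v j)) ` insert i J"
      using ex_new_if_finite[OF infinite_UNIV_char_0] by blast
    have "(u + t *\<^sub>R z) \<bullet> v j \<noteq> 0" if j: "j \<in> insert i J" for j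
    proof
      assume 0: "(u + t *\<^sub>R z) \<bullet> v j = 0"
      show False
      proof (cases "z \<bullet> v j = 0")
        case True
        then show ?thesis using 0 j u(2) zi by (auto simp: inner_add_left)
      next
        case False
        then have "t = - (u \<bullet> v j) / (z \<bullet> v j)" using 0 by (simp add: inner_add_left field_simps)
        then show ?thesis using t j by blast
      qed
    qed
    moreover have "(u + t *\<^sub>R z) \<bullet> y = 0" if "y \<in> F" for y
      using u(1) yz(2)[OF that] that by (simp add: inner_add_left orthogonal_def)
    ultimately show ?case by blast
  qed
  then show thesis using that by blast
qed

text \<open>The bound on open half-spaces passes to any subspace \<open>F\<close>: perturb \<open>\<plusminus>u\<close>, where
  \<open>u\<close> is normal to \<open>F\<close> but to no further vector, in the direction \<open>w\<close>, and add up the two bounds.\<close>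

lemma halfspace_bound_subspace:
  fixes v :: "'i \<Rightarrow> 'a::euclidean_space"
  assumes "finite I" and bound: "\<And>u. card {i \<in> I. u \<bullet> v i > 0} \<le> m" and "subspace F"
  shows "2 * card {i \<in> I. v i \<in> F \<and> w \<bullet> v i > 0} + card {i \<in> I. v i \<notin> F} \<le> 2 * m"
proof -
  define J where "J = {i \<in> I. v i \<notin> F}"
  have fJ: "finite J" using assms(1) by (simp add: J_def)
  obtain u where u: "\<And>y. y \<in> F \<Longrightarrow> u \<bullet> y = 0" "\<And>i. i \<in> J \<Longrightarrow> u \<bullet> v i \<noteq> 0"
    using generic_functional[OF fJ assms(3), of v] by (auto simp: J_def)
  have "\<forall>\<^sub>F t in at_right 0. \<forall>i\<in>J. \<bar>t * (w \<bullet> v i)\<bar> < \<bar>u \<bullet> v i\<bar>"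
  proof (intro eventually_ball_finite ballI fJ)
    fix i assume "i \<in> J"
    have "((\<lambda>t. \<bar>t * (w \<bullet> v i)\<bar>) \<longlongrightarrow> \<bar>0 * (w \<bullet> v i)\<bar>) (at_right 0)"
      by (intro tendsto_intros)
    then show "\<forall>\<^sub>F t in at_right 0. \<bar>t * (w \<bullet> v i)\<bar> < \<bar>u \<bullet> v i\<bar>"
      using u(2)[OF \<open>i \<in> J\<close>] by (intro order_tendstoD(2)) auto
  qed
  moreover have "\<forall>\<^sub>F t in at_right (0::real). t > 0" by (simp add: eventually_at_right_less)
  ultimately have "\<forall>\<^sub>F t in at_right 0. t > 0 \<and> (\<forall>i\<in>J. \<bar>t * (w \<bullet> v i)\<bar> < \<bar>u \<bullet> v i\<bar>)"
    by eventually_elim simp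
  from eventually_happens[OF this]
  obtain t :: real where t: "t > 0" "\<And>i. i \<in> J \<Longrightarrow> \<bar>t * (w \<bullet> v i)\<bar> < \<bar>u \<bullet> v i\<bar>"
    using trivial_limit_at_right_real[of "0::real"] by blast
  let ?W = "{i \<in> I. v i \<in> F \<and> w \<bullet> v i > 0}"
  let ?P = "{i \<in> J. u \<bullet> v i > 0}" and ?M = "{i \<in> J. u \<bullet> v i < 0}"
  have "?W \<union> ?P \<subseteq> {i \<in> I. (u + t *\<^sub>R w) \<bullet> v i > 0}"
  proof
    fix i assume "i \<in> ?W \<union> ?P"
    then consider "i \<in> ?W" | "i \<in> ?P" by blast
    then show "i \<in> {i \<in> I. (u + t *\<^sub>R w) \<bullet> v i > 0}"
      using u(1)[of "v i"] t(1) t(2)[of i] by cases (auto simp: inner_add_left J_def)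
  qed
  then have "card (?W \<union> ?P) \<le> m"
    by (rule order_trans[OF card_mono bound, rotated]) (use assms(1) in simp)
  moreover have "?W \<union> ?M \<subseteq> {i \<in> I. (- u + t *\<^sub>R w) \<bullet> v i > 0}"
  proof
    fix i assume "i \<in> ?W \<union> ?M"
    then consider "i \<in> ?W" | "i \<in> ?M" by blast
    then show "i \<in> {i \<in> I. (- u + t *\<^sub>R w) \<bullet> v i > 0}"
      using u(1)[of "v i"] t(1) t(2)[of i] by cases (auto simp: inner_diff_left J_def)
  qed
  then have "card (?W \<union> ?M) \<le> m"
    by (rule order_trans[OF card_mono bound, rotated]) (use assms(1) in simp)
  moreover have "card (?W \<union> ?P) = card ?W + card ?P" "card (?W \<union> ?M) = card ?W + card ?M"
    using assms(1) fJ by (auto intro!: card_Un_disjoint simp: J_def)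
  moreover have "card J = card ?P + card ?M"
  proof -
    have "J = ?P \<union> ?M" using u(2) by fastforce
    then have "card J = card (?P \<union> ?M)" by simp
    also have "\<dots> = card ?P + card ?M" using fJ by (intro card_Un_disjoint) auto
    finally show ?thesis .
  qed
  ultimately show ?thesis by (simp add: J_def)
qed

text \<open>Infinite descent: the three vectors promised for the pairs of a triangle span a
  strictly smaller triangle inside the opposite cone.\<close>

lemma no_independent_triple:
  fixes v :: "'i \<Rightarrow> 'a::real_vector"
  assumes "finite S"
    and opp: "\<And>i j. i \<in> S \<Longrightarrow> j \<in> S \<Longrightarrow> i \<noteq> j \<Longrightarrow>
                \<exists>l\<in>S. \<exists>a>0. \<exists>b>0. v l = - (a *\<^sub>R v i + b *\<^sub>R v j)"
    and "i \<in> S" "j \<in> S" "l \<in> S"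
  shows "\<exists>a b c. a *\<^sub>R v i + b *\<^sub>R v j + c *\<^sub>R v l = 0 \<and> (a \<noteq> 0 \<or> b \<noteq> 0 \<or> c \<noteq> 0)"
proof (rule ccontr)
  define cone where "cone i j l = {a *\<^sub>R v i + b *\<^sub>R v j + c *\<^sub>R v l |a b c. a \<ge> 0 \<and> b \<ge> 0 \<and> c \<ge> 0}" for i j l
  \<comment> \<open>Membership is up to sign because each descent step passes to the opposite
    cone.\<close>
  define X where "X i j l = {m \<in> S. v m \<in> cone i j l \<or> - v m \<in> cone i j l}" for i j l
  define indep where "indep i j l \<longleftrightarrow>
    (\<forall>a b c. a *\<^sub>R v i + b *\<^sub>R v j + c *\<^sub>R v l = 0 \<longrightarrow> a = 0 \<and> b = 0 \<and> c = 0)" for i j l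
  have descent: "\<not> indep i j l" if "i \<in> S" "j \<in> S" "l \<in> S" for i j l
    using that
  proof (induction "card (X i j l)" arbitrary: i j l rule: less_induct)
    case less
    show ?case
    proof
      assume ind: "indep i j l"
      then have ind0: "a = 0 \<and> b = 0 \<and> c = 0" if "a *\<^sub>R v i + b *\<^sub>R v j + c *\<^sub>R v l = 0" for a b c
        using that unfolding indep_def by blast
      have ne: "i \<noteq> j" "i \<noteq> l" "j \<noteq> l"
        using ind0[of 1 "-1" 0] ind0[of 1 0 "-1"] ind0[of 0 1 "-1"] by auto
      obtain r a b where r: "r \<in> S" "a > 0" "b > 0" "v r = - (a *\<^sub>R v i + b *\<^sub>R v j)"
        using opp[OF less.prems(1,2) ne(1)] by blast
      obtain s c d where s: "s \<in> S" "c > 0" "d > 0" "v s = - (c *\<^sub>R v i + d *\<^sub>R v l)"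
        using opp[OF less.prems(1,3) ne(2)] by blast
      obtain t e f where t: "t \<in> S" "e > 0" "f > 0" "v t = - (e *\<^sub>R v j + f *\<^sub>R v l)"
        using opp[OF less.prems(2,3) ne(3)] by blast
      have comb: "x *\<^sub>R v r + y *\<^sub>R v s + z *\<^sub>R v t =
          - ((x * a + y * c) *\<^sub>R v i + (x * b + z * e) *\<^sub>R v j + (y * d + z * f) *\<^sub>R v l)" for x y z
        unfolding r(4) s(4) t(4) by (simp add: algebra_simps)
      \<comment> \<open>Up to sign the coefficient determinant is
        \<open>a * d * e + b * c * f\<close>, a sum of positive terms.\<close>
      have "indep r s t"
        unfolding indep_def
      proof (intro allI impI)
        fix x y z assume "x *\<^sub>R v r + y *\<^sub>R v s + z *\<^sub>R v t = 0"
        then have "(x * a + y * c) *\<^sub>R v i + (x * b + z * e) *\<^sub>R v j + (y * d + z * f) *\<^sub>R v l = 0"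
          unfolding comb by (simp only: neg_equal_0_iff_equal)
        from ind0[OF this] have 0: "x * a + y * c = 0" "x * b + z * e = 0" "y * d + z * f = 0"
          by auto
        then have y: "y = - x * a / c" and z: "z = - x * b / e"
          using s t by (simp_all add: field_simps)
        have "x * (a * d / c + b * f / e) = 0"
          using 0(3) unfolding y z by (simp add: algebra_simps)
        moreover have "a * d / c + b * f / e > 0" using r s t by (simp add: add_pos_pos)
        ultimately have "x = 0" by simp
        then show "x = 0 \<and> y = 0 \<and> z = 0" using y z by simp
      qed
      moreover have "card (X r s t) < card (X i j l)"
      proof (rule psubset_card_mono)
        show "finite (X i j l)" using assms(1) by (simp add: X_def)
        have neg: "- p \<in> cone i j l" if p: "p \<in> cone r s t" for p
        proof -
          obtain x y z where xyz: "x \<ge> 0" "y \<ge> 0" "z \<ge> 0" "p = x *\<^sub>R v r + y *\<^sub>R v s + z *\<^sub>R v t"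
            using p by (auto simp: cone_def)
          have "- p = (x * a + y * c) *\<^sub>R v i + (x * b + z * e) *\<^sub>R v j + (y * d + z * f) *\<^sub>R v l"
            unfolding xyz(4) comb by simp
          moreover have "x * a + y * c \<ge> 0" "x * b + z * e \<ge> 0" "y * d + z * f \<ge> 0"
            using xyz r s t by simp_all
          ultimately show ?thesis unfolding cone_def by blast
        qed
        have "X r s t \<subseteq> X i j l" using neg by (force simp: X_def)
        moreover have "i \<in> X i j l"
        proof -
          have "v i = 1 *\<^sub>R v i + 0 *\<^sub>R v j + 0 *\<^sub>R v l" by simp
          then have "v i \<in> cone i j l" unfolding cone_def
            by (intro CollectI exI[of _ 1] exI[of _ 0]) simp
          then show ?thesis using less.prems by (simp add: X_def)
        qed
        \<comment> \<open>The vanishing coordinates along \<open>v j\<close> and \<open>v l\<close>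
          are sums of nonnegative terms; they force \<open>x = y = 0\<close>, which leaves no
          contribution along \<open>v i\<close>.\<close>
        moreover have "i \<notin> X r s t"
        proof
          assume "i \<in> X r s t"
          then obtain \<sigma> x y z where \<sigma>: "\<sigma> = 1 \<or> \<sigma> = (-1::real)" and xyz: "x \<ge> 0" "y \<ge> 0" "z \<ge> 0"
            "\<sigma> *\<^sub>R v i = x *\<^sub>R v r + y *\<^sub>R v s + z *\<^sub>R v t"
            unfolding X_def cone_def by (smt (verit) mem_Collect_eq scaleR_minus1_left scaleR_one)
          from xyz(4) have "\<sigma> *\<^sub>R v i - (x *\<^sub>R v r + y *\<^sub>R v s + z *\<^sub>R v t) = 0" by simp
          then have "(x * a + y * c + \<sigma>) *\<^sub>R v i + (x * b + z * e) *\<^sub>R v j + (y * d + z * f) *\<^sub>R v l = 0"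
            unfolding comb by (simp add: algebra_simps)
          from ind0[OF this] have 0: "x * a + y * c + \<sigma> = 0" "x * b + z * e = 0" "y * d + z * f = 0"
            by auto
          have "x * b \<ge> 0" "z * e \<ge> 0" "y * d \<ge> 0" "z * f \<ge> 0" using xyz r s t by simp_all
          then have "x * b = 0" "y * d = 0" using 0 by linarith+
          then have "x = 0" "y = 0" using r s by auto
          then show False using 0(1) \<sigma> by auto
        qed
        ultimately show "X r s t \<subset> X i j l" by blast
      qed
      ultimately show False using less.hyps[of r s t] r(1) s(1) t(1) by blast
    qed
  qed
  assume "\<not> ?thesis"
  then have "indep i j l" unfolding indep_def by blast
  then show False using descent assms(3-5) by blast
qed

section \<open>Even number of nonzero vectors: antipodal pairs\<close>

lemma zero_in_segment_opposite:
  fixes p :: "'a::real_vector"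
  assumes "c < 0"
  shows "0 \<in> closed_segment p (c *\<^sub>R p)"
proof -
  have "1 - 1 / (1 - c) + c / (1 - c) = 0" using assms by (simp add: field_simps)
  then have "(1 - 1 / (1 - c)) *\<^sub>R p + (1 / (1 - c)) *\<^sub>R (c *\<^sub>R p) = 0"
    by (metis (no_types, lifting) mult.commute mult_1 scaleR_left_distrib scaleR_scaleR scaleR_zero_left
        times_divide_eq_right)
  then show ?thesis
    unfolding in_segment using assms by (intro exI[of _ "1 / (1 - c)"]) (simp add: field_simps)
qed

text \<open>On the line through \<open>v i\<close>, let \<open>A\<close> and \<open>B\<close>
  collect the positive and negative multiples. There are \<open>2 * (k - 1)\<close> nonzero vectors
  in all, so the half-space bound for the line gives \<open>card A = card B\<close>, and
  \<open>flat\<close> gives \<open>card A + card B \<le> l\<close>. As \<open>l \<le> 3\<close> and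
  \<open>i\<close> is in \<open>A\<close>, both are singletons.\<close>

lemma antipodal_partner:
  fixes v :: "'i \<Rightarrow> 'a::euclidean_space"
  assumes fin: "finite I" and l: "l \<in> {2, 3}" and k: "l + 2 \<le> k"
    and card_I: "card I = d + 2 * (k - l)"
    and bound: "\<And>u. card {i \<in> I. u \<bullet> v i > 0} \<le> k - 1"
    and flat: "\<And>F. subspace F \<Longrightarrow> dim F < l \<Longrightarrow> card {i \<in> I. v i \<in> F} + l \<le> d + dim F + 1"
    and zero: "card {i \<in> I. v i = 0} + 2 * l = d + 2"
    and i: "i \<in> I" "v i \<noteq> 0"
  shows "\<exists>j\<in>I. \<exists>c<0. v j = c *\<^sub>R v i"
    and "\<And>j c. j \<in> I \<Longrightarrow> c > 0 \<Longrightarrow> v j = c *\<^sub>R v i \<Longrightarrow> j = i"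
proof -
  define F where "F = span {v i}"
  have F: "subspace F" "dim F \<le> 1" unfolding F_def using dim_le_card'[of "{v i}"] by auto
  define Z where "Z = {j \<in> I. v j = 0}"
  define A where "A = {j \<in> I. v j \<in> F \<and> v i \<bullet> v j > 0}"
  define B where "B = {j \<in> I. v j \<in> F \<and> (- v i) \<bullet> v j > 0}"
  have mult: "\<exists>c. v j = c *\<^sub>R v i" if "v j \<in> F" for j
    using that by (auto simp: F_def span_singleton)
  have vi: "v i \<bullet> v i > 0" using i by simp
  have "{j \<in> I. v j \<in> F} = Z \<union> A \<union> B"
  proof
    show "{j \<in> I. v j \<in> F} \<subseteq> Z \<union> A \<union> B"
    proof
      fix j assume j: "j \<in> {j \<in> I. v j \<in> F}"
      then obtain c where c: "v j = c *\<^sub>R v i" using mult by blast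
      consider "c = 0" | "c > 0" | "c < 0" by linarith
      then show "j \<in> Z \<union> A \<union> B"
        using j c vi by cases (auto simp: Z_def A_def B_def mult_neg_pos)
    qed
    show "Z \<union> A \<union> B \<subseteq> {j \<in> I. v j \<in> F}"
      using subspace_0[OF F(1)] by (auto simp: Z_def A_def B_def)
  qed
  moreover have fZ: "finite Z" "finite A" "finite B" using fin by (auto simp: Z_def A_def B_def)
  moreover have "Z \<inter> A = {}" "(Z \<union> A) \<inter> B = {}" by (auto simp: Z_def A_def B_def)
  ultimately have cF: "card {j \<in> I. v j \<in> F} = card Z + card A + card B"
    by (simp add: card_Un_disjoint)
  have "card I = card {j \<in> I. v j \<in> F} + card {j \<in> I. v j \<notin> F}"
    using card_Int_Diff[OF fin, of "{j. v j \<in> F}"] by (simp add: Int_def set_diff_eq)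
  moreover have "2 * card A + card {j \<in> I. v j \<notin> F} \<le> 2 * (k - 1)"
    unfolding A_def by (rule halfspace_bound_subspace[OF fin bound F(1)])
  moreover have "2 * card B + card {j \<in> I. v j \<notin> F} \<le> 2 * (k - 1)"
    unfolding B_def by (rule halfspace_bound_subspace[OF fin bound F(1)])
  moreover have "card {j \<in> I. v j \<in> F} + l \<le> d + 2"
    using flat[OF F(1)] F(2) l by fastforce
  moreover have iA: "i \<in> A" using i vi by (auto simp: A_def F_def span_base)
  then have "card A \<ge> 1" using fZ by (metis One_nat_def Suc_leI card_gt_0_iff empty_iff)
  moreover have "card Z + 2 * l = d + 2" using zero by (simp add: Z_def)
  ultimately have ab: "card A = 1" "card B = 1"
    using cF card_I k l by auto
  from ab(2) obtain j where "j \<in> B" by (metis card_1_singletonE insertI1)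
  then have j: "j \<in> I" "v j \<in> F" "v i \<bullet> v j < 0" by (auto simp: B_def)
  then obtain c where c: "v j = c *\<^sub>R v i" using mult by blast
  then have "c < 0" using j(3) vi by (simp add: mult_less_0_iff)
  then show "\<exists>j\<in>I. \<exists>c<0. v j = c *\<^sub>R v i" using j(1) c by blast
  show "j = i" if "j \<in> I" "c > 0" "v j = c *\<^sub>R v i" for j c
  proof -
    have "j \<in> A" using that vi by (auto simp: A_def F_def span_base span_mul)
    then show ?thesis using ab(1) iA by (metis card_1_singletonE singletonD)
  qed
qed

text \<open>Zero vectors supply the diagonal pairs. The proper pairs join vectors on the positive
  side of a generic \<open>u\<close> to their partners, which lie on the negative side, so the two
  kinds of endpoints cannot collide.\<close>

lemma antipodal_pattern:
  fixes v :: "'i \<Rightarrow> 'a::euclidean_space"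
  assumes fin: "finite I" and l: "l \<in> {2, 3}" and k: "l + 2 \<le> k"
    and card_I: "card I = d + 2 * (k - l)"
    and bound: "\<And>u. card {i \<in> I. u \<bullet> v i > 0} \<le> k - 1"
    and flat: "\<And>F. subspace F \<Longrightarrow> dim F < l \<Longrightarrow> card {i \<in> I. v i \<in> F} + l \<le> d + dim F + 1"
    and zero: "card {i \<in> I. v i = 0} + 2 * l = d + 2"
  shows "\<exists>P\<in>patterns d l I. \<forall>e\<in>P. 0 \<in> closed_segment (v (fst e)) (v (snd e))"
proof -
  note partner = antipodal_partner[OF fin l k card_I bound flat zero]
  define Z where "Z = {i \<in> I. v i = 0}"
  have fZ: "finite Z" using fin by (simp add: Z_def)
  have "\<forall>i\<in>I - Z. \<exists>j c. j \<in> I \<and> c < 0 \<and> v j = c *\<^sub>R v i"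
    using partner(1) by (force simp: Z_def)
  then obtain \<tau> c where \<tau>: "\<And>i. i \<in> I - Z \<Longrightarrow> \<tau> i \<in> I" "\<And>i. i \<in> I - Z \<Longrightarrow> c i < (0::real)"
    "\<And>i. i \<in> I - Z \<Longrightarrow> v (\<tau> i) = c i *\<^sub>R v i" by metis
  obtain u where u: "\<And>i. i \<in> I - Z \<Longrightarrow> u \<bullet> v i \<noteq> 0"
    using generic_functional[of "I - Z" "{0}" v] fin by (auto simp: Z_def)
  define Q where "Q = {i \<in> I. u \<bullet> v i > 0}"
  define Q' where "Q' = {i \<in> I. (- u) \<bullet> v i > 0}"
  have fQ: "finite Q" "finite Q'" using fin by (simp_all add: Q_def Q'_def)
  have "I - Z = Q \<union> Q'" using u by (force simp: Q_def Q'_def Z_def)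
  moreover have "Q \<inter> Q' = {}" by (auto simp: Q_def Q'_def)
  ultimately have "card (I - Z) = card Q + card Q'" using fQ by (simp add: card_Un_disjoint)
  moreover have "card (I - Z) = card I - card Z" by (rule card_Diff_subset[OF fZ]) (auto simp: Z_def)
  moreover have "card Z + 2 * l = d + 2" using zero by (simp add: Z_def)
  moreover have "card Q' \<le> k - 1" unfolding Q'_def by (rule bound)
  \<comment> \<open>At most half of the \<open>2 * (k - 1)\<close> nonzero vectors are in
    \<open>Q'\<close>, so \<open>Q\<close> has at least \<open>k - 1\<close>, and
    \<open>k \<ge> l + 2\<close>.\<close>
  ultimately have "card Q \<ge> l + 1" using card_I k l by auto
  then obtain Y where Y: "Y \<subseteq> Q" "card Y = l + 1" by (metis obtain_subset_with_card_n)
  have fY: "finite Y" using Y(1) fQ finite_subset by blast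
  have YI: "i \<in> I - Z" if "i \<in> Y" for i using that Y(1) by (auto simp: Q_def Z_def)
  have uY: "u \<bullet> v i > 0" "u \<bullet> v (\<tau> i) < 0" if "i \<in> Y" for i
  proof -
    show *: "u \<bullet> v i > 0" using that Y(1) by (auto simp: Q_def)
    then show "u \<bullet> v (\<tau> i) < 0" using \<tau>(2,3)[OF YI[OF that]] by (simp add: mult_neg_pos)
  qed
  have \<tau>Y: "\<tau> i \<notin> Y" "\<tau> i \<notin> Z" if "i \<in> Y" for i
    using uY(2)[OF that] uY(1)[of "\<tau> i"] by (auto simp: Z_def)
  have \<tau>inj: "inj_on \<tau> Y"
  proof (rule inj_onI)
    fix i j assume ij: "i \<in> Y" "j \<in> Y" "\<tau> i = \<tau> j"
    then have eq: "c i *\<^sub>R v i = c j *\<^sub>R v j" using \<tau>(3) YI by metis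
    have neg: "c i < 0" "c j < 0" using \<tau>(2) YI ij by auto
    have "v i = (1 / c i) *\<^sub>R (c i *\<^sub>R v i)" using neg by simp
    also have "\<dots> = (c j / c i) *\<^sub>R v j" unfolding eq by simp
    finally have "v i = (c j / c i) *\<^sub>R v j" .
    moreover have "c j / c i > 0" using neg by (simp add: divide_neg_neg)
    ultimately show "i = j" using partner(2)[of j i] YI ij by (auto simp: Z_def)
  qed
  define P where "P = (\<lambda>i. (i, i)) ` Z \<union> (\<lambda>i. (i, \<tau> i)) ` Y"
  have ZY: "Z \<inter> Y = {}" using YI by blast
  have "proper P = (\<lambda>i. (i, \<tau> i)) ` Y" using \<tau>Y by (force simp: P_def proper_def)
  then have "card (proper P) = l + 1" using Y(2) by (simp add: card_image inj_on_def)
  moreover have "card P = card Z + card Y"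
  proof -
    have "card P = card ((\<lambda>i. (i, i)) ` Z) + card ((\<lambda>i. (i, \<tau> i)) ` Y)"
      unfolding P_def using fZ fY ZY by (intro card_Un_disjoint) auto
    then show ?thesis by (simp add: card_image inj_on_def)
  qed
  then have "card P + l = d + 3" using zero Y(2) by (simp add: Z_def)
  moreover have "P \<subseteq> I \<times> I" using \<tau>(1) YI by (auto simp: P_def Z_def)
  moreover have "disjoint_pairs P"
    unfolding disjoint_pairs_def
  proof (intro conjI ballI impI)
    show "inj_on fst P" using ZY by (auto simp: P_def inj_on_def)
    show "inj_on snd P" using ZY \<tau>Y \<tau>inj by (force simp: P_def inj_on_def)
    show "e = f" if "e \<in> P" "f \<in> P" "fst e = snd f" for e f
      using that ZY \<tau>Y by (auto simp: P_def)
  qed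
  ultimately have "P \<in> patterns d l I" by (simp add: patterns_def)
  moreover have "0 \<in> closed_segment (v (fst e)) (v (snd e))" if "e \<in> P" for e
    using that \<tau>(2,3) YI by (auto simp: P_def Z_def intro!: zero_in_segment_opposite)
  ultimately show ?thesis by blast
qed

section \<open>Odd number of nonzero vectors, \<open>l = 3\<close>\<close>

lemma functional_two_values:
  fixes p q :: "'a::euclidean_space"
  assumes "p \<noteq> 0" "q \<notin> span {p}"
  obtains w where "w \<bullet> p = s" "w \<bullet> q = t"
proof -
  obtain y z where yz: "y \<in> span {p}" "\<And>w. w \<in> span {p} \<Longrightarrow> orthogonal z w" "q = y + z"
    using orthogonal_subspace_decomp_exists[of "{p}" q] by blast
  have zp: "z \<bullet> p = 0" "z \<bullet> y = 0"
    using yz(2)[OF span_base[of p]] yz(2)[OF yz(1)] by (simp_all add: orthogonal_def)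
  have "z \<noteq> 0" using yz assms(2) by auto
  then have zq: "z \<bullet> q \<noteq> 0" using zp by (simp add: yz(3) inner_add_right)
  define \<alpha> where "\<alpha> = s / (p \<bullet> p)"
  define w where "w = \<alpha> *\<^sub>R p + ((t - \<alpha> * (p \<bullet> q)) / (z \<bullet> q)) *\<^sub>R z"
  have "w \<bullet> p = s" using assms(1) zp by (simp add: w_def \<alpha>_def inner_add_left)
  moreover have "w \<bullet> q = t" using zq by (simp add: w_def inner_add_left)
  ultimately show thesis using that by blast
qed

text \<open>There are \<open>2 * k - 3\<close> nonzero vectors. General position allows at most two
  of them on a line and three in a plane (\<open>flatJ\<close>), while the half-space bound lets a
  side of any subspace \<open>F\<close> exceed the other part of \<open>F\<close> by at most one
  (\<open>posJ\<close>).\<close>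

lemma no_odd_halving:
  fixes v :: "'i \<Rightarrow> 'a::euclidean_space"
  assumes fin: "finite I" and k: "5 \<le> k" and card_I: "card I = d + 2 * (k - 3)"
    and bound: "\<And>u. card {i \<in> I. u \<bullet> v i > 0} \<le> k - 1"
    and flat: "\<And>F. subspace F \<Longrightarrow> dim F < 3 \<Longrightarrow> card {i \<in> I. v i \<in> F} + 3 \<le> d + dim F + 1"
    and zero: "card {i \<in> I. v i = 0} + 3 = d"
  shows False
proof -
  define J where "J = {i \<in> I. v i \<noteq> 0}"
  have fJ: "finite J" using fin by (simp add: J_def)
  have split: "card {i \<in> I. v i \<in> F} = card {i \<in> I. v i = 0} + card {i \<in> J. v i \<in> F}"
    if "subspace F" for F
  proof -
    have "{i \<in> I. v i \<in> F} = {i \<in> I. v i = 0} \<union> {i \<in> J. v i \<in> F}"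
      using subspace_0[OF that] by (auto simp: J_def)
    also have "card \<dots> = card {i \<in> I. v i = 0} + card {i \<in> J. v i \<in> F}"
      using fin fJ by (intro card_Un_disjoint) (auto simp: J_def)
    finally show ?thesis .
  qed
  have flatJ: "card {i \<in> J. v i \<in> F} \<le> dim F + 1" if "subspace F" "dim F < 3" for F
    using flat[OF that] split[OF that(1)] zero by linarith
  have posJ: "2 * card {i \<in> J. v i \<in> F \<and> w \<bullet> v i > 0} \<le> card {i \<in> J. v i \<in> F} + 1"
    if "subspace F" for F w
  proof -
    have "card I = card {i \<in> I. v i \<in> F} + card {i \<in> I. v i \<notin> F}"
      using card_Int_Diff[OF fin, of "{j. v j \<in> F}"] by (simp add: Int_def set_diff_eq)
    moreover have "{i \<in> I. v i \<in> F \<and> w \<bullet> v i > 0} = {i \<in> J. v i \<in> F \<and> w \<bullet> v i > 0}"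
      by (auto simp: J_def)
    ultimately show ?thesis
      using halfspace_bound_subspace[OF fin bound that, of w] split[OF that] card_I k zero by simp
  qed
  have line: "card {i \<in> J. v i \<in> span {p}} \<le> 2" for p
    using flatJ[of "span {p}"] dim_le_card'[of "{p}"] by simp
  have plane: "card {i \<in> J. v i \<in> span {p, q}} \<le> 3" for p q
  proof -
    have "dim (span {p, q}) \<le> 2"
      using dim_le_card'[of "{p, q}"] card_insert_le_m1[of 2 "{q}" p] by simp
    then show ?thesis using flatJ[of "span {p, q}"] by simp
  qed
  have line_set: "card D \<le> 2" if "D \<subseteq> J" "\<And>i. i \<in> D \<Longrightarrow> v i \<in> span {p}" for D p
    using card_mono[of "{i \<in> J. v i \<in> span {p}}" D] line[of p] that fJ by fastforce
  have plane_set: "card D \<le> 3" if "D \<subseteq> J" "\<And>i. i \<in> D \<Longrightarrow> v i \<in> span {p, q}" for D p q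
    using card_mono[of "{i \<in> J. v i \<in> span {p, q}}" D] plane[of p q] that fJ by fastforce
  have par_sym: "v i \<in> span {v j}" if ij: "v j \<in> span {v i}" "j \<in> J" for i j
  proof -
    obtain c where "v j = c *\<^sub>R v i" using ij(1) by (auto simp: span_singleton)
    moreover from this have "c \<noteq> 0" using ij(2) by (auto simp: J_def)
    ultimately have "v i = (1 / c) *\<^sub>R v j" by simp
    then show ?thesis by (metis span_base span_mul singletonI)
  qed
  have par_trans: "v i \<in> span {p}" if "v i \<in> span {v j}" "v j \<in> span {p}" for i j p
    using that by (metis empty_subsetI insert_subset span_minimal subsetD subspace_span)
  define S where "S = {i \<in> J. \<forall>j\<in>J. v j \<in> span {v i} \<longrightarrow> j = i}"
  have SJ: "S \<subseteq> J" by (auto simp: S_def)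
  have fS: "finite S" using SJ fJ finite_subset by blast
  have "card (J - S) \<le> 2"
  proof (cases "J - S = {}")
    case False
    then obtain i where i: "i \<in> J - S" by blast
    then obtain j where j: "j \<in> J" "v j \<in> span {v i}" "j \<noteq> i" by (auto simp: S_def)
    \<comment> \<open>A third vector parallel to \<open>v i\<close> breaks the bound for lines; a
      second parallel pair would put four vectors in one plane.\<close>
    have "J - S \<subseteq> {i, j}"
    proof (rule ccontr)
      assume "\<not> J - S \<subseteq> {i, j}"
      then obtain g where g: "g \<in> J - S" "g \<noteq> i" "g \<noteq> j" by blast
      then obtain h where h: "h \<in> J" "v h \<in> span {v g}" "h \<noteq> g" by (auto simp: S_def)
      have vi: "v i \<in> span {v i}" by (simp add: span_base)
      show False
      proof (cases "h \<in> {i, j}")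
        case True
        then have "v h \<in> span {v i}" using j vi by auto
        moreover have "v g \<in> span {v h}" using par_sym[OF h(2,1)] .
        ultimately have "v g \<in> span {v i}" using par_trans by blast
        then have "card {i, j, g} \<le> 2" using i j g vi by (intro line_set[of _ "v i"]) auto
        then show False using j(3) g by simp
      next
        case False
        have sub: "span {v i} \<subseteq> span {v i, v g}" "span {v g} \<subseteq> span {v i, v g}"
          by (auto intro!: span_mono)
        have "card {i, j, g, h} \<le> 3"
        proof (rule plane_set[of _ "v i" "v g"])
          show "{i, j, g, h} \<subseteq> J" using i j g h by auto
          show "v m \<in> span {v i, v g}" if "m \<in> {i, j, g, h}" for m
            using that sub j(2) h(2) by (auto simp: span_base)
        qed
        then show False using j(3) g h False by (auto simp: card_insert_if)
      qed
    qed
    then have "card (J - S) \<le> card {i, j}" by (intro card_mono) auto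
    then show ?thesis using j by simp
  qed (simp only: card.empty)
  moreover have "card (J - S) = card J - card S" using fS SJ by (rule card_Diff_subset)
  moreover have "card J + card {i \<in> I. v i = 0} = card I"
  proof -
    have "I = J \<union> {i \<in> I. v i = 0}" by (auto simp: J_def)
    then have "card I = card (J \<union> {i \<in> I. v i = 0})" by simp
    also have "\<dots> = card J + card {i \<in> I. v i = 0}"
      using fin fJ by (intro card_Un_disjoint) (auto simp: J_def)
    finally show ?thesis by simp
  qed
  ultimately have card_S: "card S \<ge> 5" using card_I k zero by linarith
  have notpar: "v j \<notin> span {v i}" if "i \<in> S" "j \<in> S" "i \<noteq> j" for i j
    using that by (auto simp: S_def)
  have opp: "\<exists>l\<in>S. \<exists>a>0. \<exists>b>0. v l = - (a *\<^sub>R v i + b *\<^sub>R v j)"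
    if ij: "i \<in> S" "j \<in> S" "i \<noteq> j" for i j
  proof -
    define F where "F = span {v i, v j}"
    define G where "G = {m \<in> J. v m \<in> F}"
    have fG: "finite G" using fJ by (simp add: G_def)
    have ijJ: "i \<in> J" "j \<in> J" using ij SJ by auto
    have ijF: "v i \<in> F" "v j \<in> F" by (auto simp: F_def span_base)
    have ijG: "i \<in> G" "j \<in> G" using ijJ ijF by (auto simp: G_def)
    have pos: "2 * card D \<le> card G + 1" if "D \<subseteq> G" "\<And>m. m \<in> D \<Longrightarrow> w \<bullet> v m > 0" for D w
    proof -
      have "card D \<le> card {m \<in> J. v m \<in> F \<and> w \<bullet> v m > 0}"
        using that fJ by (intro card_mono) (auto simp: G_def)
      then show ?thesis using posJ[of F w] by (simp add: F_def G_def)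
    qed
    have two: "\<exists>w. w \<bullet> v i = s \<and> w \<bullet> v j = t" for s t
      using functional_two_values[of "v i" "v j" s t] notpar[OF ij] ijJ by (auto simp: J_def)
    obtain w where "w \<bullet> v i = 1" "w \<bullet> v j = 1" using two by blast
    \<comment> \<open>Two vectors on one side force a third in the plane; with exactly three there,
      \<open>no3\<close> forbids all of them on one side.\<close>
    then have "2 * card {i, j} \<le> card G + 1" using ijG by (intro pos[of _ w]) auto
    then have "card G \<ge> 3" using ij(3) by simp
    then have "\<not> G \<subseteq> {i, j}" using card_mono[of "{i, j}" G] ij(3) by auto
    then obtain l where l: "l \<in> G" "l \<noteq> i" "l \<noteq> j" by blast
    have "card G \<le> 3" using plane[of "v i" "v j"] by (simp add: G_def F_def)
    have no3: "\<not> (w \<bullet> v i > 0 \<and> w \<bullet> v j > 0 \<and> w \<bullet> v l > 0)" for w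
    proof
      assume "w \<bullet> v i > 0 \<and> w \<bullet> v j > 0 \<and> w \<bullet> v l > 0"
      then have "2 * card {i, j, l} \<le> card G + 1" using ijG l by (intro pos[of _ w]) auto
      then show False using \<open>card G \<le> 3\<close> l ij(3) by (auto simp: card_insert_if)
    qed
    obtain a b where ab: "v l = a *\<^sub>R v i + b *\<^sub>R v j"
    proof -
      have "v l \<in> span (insert (v i) {v j})" using l(1) by (simp add: G_def F_def)
      then obtain a where "v l - a *\<^sub>R v i \<in> span {v j}" using span_breakdown_eq by blast
      then obtain b where "v l - a *\<^sub>R v i = b *\<^sub>R v j" by (auto simp: span_singleton)
      then show thesis using that[of a b] by (simp add: algebra_simps)
    qed
    have "l \<in> J" using l(1) by (simp add: G_def)
    have "\<not> a > 0"
    proof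
      assume a: "a > 0"
      \<comment> \<open>Chosen so that \<open>w \<bullet> v l = 1 + \<bar>b\<bar> + b > 0\<close>,
        against \<open>no3\<close>.\<close>
      obtain w where w: "w \<bullet> v i = (1 + \<bar>b\<bar>) / a" "w \<bullet> v j = 1" using two by blast
      have "w \<bullet> v l = a * ((1 + \<bar>b\<bar>) / a) + b" unfolding ab by (simp add: inner_add_right w)
      also have "\<dots> > 0" using a by simp
      finally show False using no3[of w] w a by simp
    qed
    moreover have "\<not> b > 0"
    proof
      assume b: "b > 0"
      obtain w where w: "w \<bullet> v i = 1" "w \<bullet> v j = (1 + \<bar>a\<bar>) / b" using two by blast
      have "w \<bullet> v l = a + b * ((1 + \<bar>a\<bar>) / b)" unfolding ab by (simp add: inner_add_right w)
      also have "\<dots> > 0" using b by simp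
      finally show False using no3[of w] w b by simp
    qed
    moreover have "a \<noteq> 0"
    proof
      assume "a = 0"
      then have "v l \<in> span {v j}" using ab by (simp add: span_base span_mul)
      then show False using ij(2) \<open>l \<in> J\<close> l by (auto simp: S_def)
    qed
    moreover have "b \<noteq> 0"
    proof
      assume "b = 0"
      then have "v l \<in> span {v i}" using ab by (simp add: span_base span_mul)
      then show False using ij(1) \<open>l \<in> J\<close> l by (auto simp: S_def)
    qed
    ultimately have neg: "- a > 0" "- b > 0" by auto
    \<comment> \<open>Needed for \<open>l\<close> to stay in \<open>S\<close>: a vector parallel to
      \<open>v l\<close> lies in the plane, whose only members are \<open>i\<close>,
      \<open>j\<close> and \<open>l\<close>.\<close>
    have "h = l" if h: "h \<in> J" "v h \<in> span {v l}" for h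
    proof (rule ccontr)
      assume "h \<noteq> l"
      have "span {v l} \<subseteq> F" using l(1) by (intro span_minimal) (auto simp: G_def F_def)
      then have "v h \<in> F" using h(2) by blast
      show False
      proof (cases "h \<in> {i, j}")
        case True
        have "v l \<in> span {v h}" using par_sym[OF h(2,1)] .
        then show False using True ij(1,2) l \<open>l \<in> J\<close> by (auto simp: S_def)
      next
        case False
        have "{i, j, l, h} \<subseteq> G" using ijG l(1) h(1) \<open>v h \<in> F\<close> by (auto simp: G_def)
        then have "card {i, j, l, h} \<le> card G" using fG by (rule card_mono[rotated])
        then show False using \<open>card G \<le> 3\<close> False \<open>h \<noteq> l\<close> l ij(3) by (auto simp: card_insert_if)
      qed
    qed
    then have "l \<in> S" using \<open>l \<in> J\<close> by (auto simp: S_def)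
    moreover have "v l = - ((- a) *\<^sub>R v i + (- b) *\<^sub>R v j)" using ab by simp
    ultimately show ?thesis using neg by blast
  qed
  obtain i where i: "i \<in> S" using card_S by fastforce
  have "\<not> S \<subseteq> {i}" using card_S card_mono[of "{i}" S] by auto
  then obtain j where j: "j \<in> S" "i \<noteq> j" by blast
  have "\<not> S \<subseteq> {m \<in> J. v m \<in> span {v i, v j}}"
    using card_S plane[of "v i" "v j"] card_mono[of "{m \<in> J. v m \<in> span {v i, v j}}" S] fJ by fastforce
  then obtain l where l: "l \<in> S" "v l \<notin> span {v i, v j}" using SJ by blast
  obtain a b c where abc: "a *\<^sub>R v i + b *\<^sub>R v j + c *\<^sub>R v l = 0" "a \<noteq> 0 \<or> b \<noteq> 0 \<or> c \<noteq> 0"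
    using no_independent_triple[OF fS opp i j(1) l(1)] by blast
  have "c = 0"
  proof (rule ccontr)
    assume c: "c \<noteq> 0"
    have "c *\<^sub>R v l = - (a *\<^sub>R v i + b *\<^sub>R v j)" using abc(1) by (simp only: add_eq_0_iff)
    also have "\<dots> \<in> span {v i, v j}" by (intro span_neg span_add span_mul span_base) auto
    finally have "c *\<^sub>R v l \<in> span {v i, v j}" .
    then have "(1 / c) *\<^sub>R (c *\<^sub>R v l) \<in> span {v i, v j}" by (rule span_mul)
    then show False using l(2) c by simp
  qed
  have "b = 0"
  proof (rule ccontr)
    assume b: "b \<noteq> 0"
    have "a *\<^sub>R v i + b *\<^sub>R v j = 0" using abc(1) \<open>c = 0\<close> by simp
    then have "b *\<^sub>R v j = - (a *\<^sub>R v i)" by (simp only: add_eq_0_iff)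
    also have "\<dots> \<in> span {v i}" by (intro span_neg span_mul span_base) auto
    finally have "b *\<^sub>R v j \<in> span {v i}" .
    then have "(1 / b) *\<^sub>R (b *\<^sub>R v j) \<in> span {v i}" by (rule span_mul)
    then show False using notpar[OF i j] b by simp
  qed
  have "v i \<noteq> 0" using i SJ by (auto simp: J_def)
  then show False using abc \<open>b = 0\<close> \<open>c = 0\<close> by simp
qed

section \<open>Projection along a transversal plane\<close>

text \<open>The orthogonal projection onto the complement of \<open>S\<close> stands in for the
  quotient by \<open>S\<close> and keeps its values in the same type.\<close>

lemma linear_projection_along:
  fixes S :: "'a::euclidean_space set"
  assumes "subspace S"
  obtains \<pi> :: "'a \<Rightarrow> 'a" where "linear \<pi>" "\<And>y. \<pi> y = 0 \<longleftrightarrow> y \<in> S" "\<And>y. y - \<pi> y \<in> S"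
proof -
  obtain B where B: "pairwise orthogonal B" "B \<subseteq> S" "span B = S"
    using orthogonal_basis_subspace[OF assms] by metis
  define proj where "proj y = (\<Sum>b\<in>B. (b \<bullet> y / (b \<bullet> b)) *\<^sub>R b)" for y
  have proj: "proj y \<in> S" for y
    unfolding proj_def using assms B(2) by (intro subspace_sum subspace_scale) auto
  have "linear (\<lambda>y. y - proj y)"
    unfolding proj_def
    by (intro linearI) (simp_all add: inner_add_right add_divide_distrib scaleR_left_distrib
        sum.distrib scaleR_diff_right scaleR_sum_right)
  moreover have "y - proj y = 0 \<longleftrightarrow> y \<in> S" for y
  proof
    assume "y - proj y = 0"
    then show "y \<in> S" using proj[of y] by simp
  next
    assume "y \<in> S"
    then have "y - proj y \<in> span B" using subspace_diff[OF assms _ proj] B(3) by simp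
    then have "orthogonal (y - proj y) (y - proj y)"
      using Gram_Schmidt_step[OF B(1), of "y - proj y" y] by (simp add: proj_def orthogonal_commute)
    then show "y - proj y = 0" by (simp add: orthogonal_self)
  qed
  moreover have "y - (y - proj y) \<in> S" for y using proj by simp
  ultimately show thesis by (rule that)
qed

text \<open>If \<open>k\<close> vectors had \<open>u \<bullet> v i > 0\<close>, the hull of their
  points would lie strictly on one side of a hyperplane (or of nothing, if \<open>u\<close> vanishes
  on the image) that contains \<open>L\<close>. For \<open>flat\<close>, the preimage of
  \<open>F\<close> is a flat of dimension at most \<open>d - l + dim F < d\<close>, to which general
  position applies.\<close>

lemma transversal_projection:
  fixes x :: "'i \<Rightarrow> 'a::euclidean_space"
  assumes N: "x \<in> general_tuples N" "finite N" "DIM('a) + 1 \<le> card N"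
    and L: "affine L" "aff_dim L = int DIM('a) - int l" "l \<le> DIM('a)"
    and k: "k > 0"
    and trans: "\<And>T. T \<subseteq> N \<Longrightarrow> card T = k \<Longrightarrow> L \<inter> convex hull (x ` T) \<noteq> {}"
  obtains v :: "'i \<Rightarrow> 'a" where "\<And>i. v i = 0 \<longleftrightarrow> x i \<in> L"
    "\<And>u. card {i \<in> N. u \<bullet> v i > 0} \<le> k - 1"
    "\<And>F. subspace F \<Longrightarrow> dim F < l \<Longrightarrow> card {i \<in> N. v i \<in> F} + l \<le> DIM('a) + dim F + 1"
    "\<And>i j. 0 \<in> closed_segment (v i) (v j) \<Longrightarrow> \<exists>q\<in>L. q \<in> closed_segment (x i) (x j)"
proof -
  have "L \<noteq> {}" using L by auto
  then obtain p where p: "p \<in> L" by blast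
  define S where "S = (\<lambda>y. y - p) ` L"
  have S: "subspace S" unfolding S_def by (rule affine_diffs_subspace_subtract[OF L(1) p])
  have dimS: "int (dim S) = int DIM('a) - int l"
    using aff_dim_translation_eq_subtract[of p L] aff_dim_subspace[OF S] L(2) by (simp add: S_def)
  obtain \<pi> :: "'a \<Rightarrow> 'a" where \<pi>: "linear \<pi>" "\<And>y. \<pi> y = 0 \<longleftrightarrow> y \<in> S" "\<And>y. y - \<pi> y \<in> S"
    using linear_projection_along[OF S] by blast
  have L_iff: "y \<in> L \<longleftrightarrow> \<pi> (y - p) = 0" for y by (auto simp: \<pi>(2) S_def)
  define v where "v i = \<pi> (x i - p)" for i
  have "card {i \<in> N. u \<bullet> v i > 0} \<le> k - 1" for u
  proof (rule ccontr)
    assume "\<not> ?thesis"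
    then have "k \<le> card {i \<in> N. u \<bullet> v i > 0}" using k by simp
    then obtain T where T: "T \<subseteq> {i \<in> N. u \<bullet> v i > 0}" "card T = k"
      by (metis obtain_subset_with_card_n)
    then obtain q where q: "q \<in> L" "q \<in> convex hull (x ` T)" using trans[of T] by auto
    define f where "f y = u \<bullet> \<pi> y" for y
    have f: "linear f"
      unfolding f_def using linear_compose[OF \<pi>(1) bounded_linear.linear[OF bounded_linear_inner_right]]
      by (simp add: o_def)
    have fv: "f y - f p = u \<bullet> \<pi> (y - p)" for y
      by (simp add: f_def linear_diff[OF \<pi>(1)] inner_diff_right)
    have "convex (f -` {f p<..})" by (intro convex_linear_vimage f convex_real_interval)
    moreover have "x ` T \<subseteq> f -` {f p<..}"
    proof (intro image_subsetI vimageI2)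
      fix i assume "i \<in> T"
      then have "u \<bullet> \<pi> (x i - p) > 0" using T(1) by (auto simp: v_def)
      then show "f (x i) \<in> {f p<..}" using fv[of "x i"] by simp
    qed
    ultimately have "convex hull (x ` T) \<subseteq> f -` {f p<..}" by (rule hull_minimal[rotated])
    then have "f q > f p" using q by auto
    then show False using fv[of q] q(1) L_iff by simp
  qed
  moreover have "card {i \<in> N. v i \<in> F} + l \<le> DIM('a) + dim F + 1" if F: "subspace F" "dim F < l" for F
  proof -
    let ?E = "{s + f |s f. s \<in> S \<and> f \<in> F}"
    have "subspace ?E" using subspace_sums[OF S F(1)] .
    moreover have "dim ?E \<le> dim S + dim F" using dim_sums_Int[OF S F(1)] by simp
    ultimately have "aff_dim ((+) p ` ?E) \<le> int (DIM('a) - l + dim F)"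
      unfolding aff_dim_translation_eq using dimS L(3) by (simp add: aff_dim_subspace)
    then have "card {i \<in> N. x i \<in> (+) p ` ?E} \<le> DIM('a) - l + dim F + 1"
      using F(2) L(3) by (intro general_tuples_card_affine[OF N]) auto
    moreover have "{i \<in> N. v i \<in> F} \<subseteq> {i \<in> N. x i \<in> (+) p ` ?E}"
    proof safe
      fix i assume "v i \<in> F"
      have "x i - p - v i \<in> S" using \<pi>(3)[of "x i - p"] by (simp add: v_def)
      then have "(x i - p - v i) + v i \<in> ?E" using \<open>v i \<in> F\<close> by blast
      then show "x i \<in> (+) p ` ?E" by (intro image_eqI[of _ _ "x i - p"]) auto
    qed
    then have "card {i \<in> N. v i \<in> F} \<le> card {i \<in> N. x i \<in> (+) p ` ?E}"
      using N(2) by (intro card_mono) auto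
    ultimately show ?thesis using L(3) by linarith
  qed
  moreover have "\<exists>q\<in>L. q \<in> closed_segment (x i) (x j)" if ij: "0 \<in> closed_segment (v i) (v j)" for i j
  proof -
    obtain t where t: "0 \<le> t" "t \<le> 1" "(1 - t) *\<^sub>R v i + t *\<^sub>R v j = 0"
      using ij unfolding in_segment by metis
    let ?q = "(1 - t) *\<^sub>R x i + t *\<^sub>R x j"
    have "?q - p = (1 - t) *\<^sub>R (x i - p) + t *\<^sub>R (x j - p)" by (simp add: algebra_simps)
    then have "\<pi> (?q - p) = (1 - t) *\<^sub>R v i + t *\<^sub>R v j"
      by (simp only: v_def linear_add[OF \<pi>(1)] linear_scale[OF \<pi>(1)])
    then have "?q \<in> L" using t(3) L_iff by simp
    then show ?thesis using t(1,2) by (auto simp: in_segment)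
  qed
  moreover have "v i = 0 \<longleftrightarrow> x i \<in> L" for i by (simp add: v_def L_iff)
  ultimately show thesis using that[of v] by blast
qed

theorem theorem2p1:
  fixes l d k n :: nat
    and x :: "nat \<Rightarrow> real ^ 'd"
    and \<epsilon> :: real
  assumes "l \<in> {2, 3}"
    and "d = CARD('d)"
    and "d \<ge> l"
    and "k \<ge> l + 2"
    and "n = d + 2 * (k - l)"
    and "\<epsilon> > 0"
  shows "\<exists>x' :: nat \<Rightarrow> real ^ 'd.
           inj_on x' {1..n} \<and>
           general_position (x' ` {1..n}) \<and>
           (\<forall>i\<in>{1..n}. norm (x i - x' i) < \<epsilon>) \<and>
           (\<forall>L. is_plane (d - l) L \<and>
                 transversal L ((hull) convex ` k_sets k (x' ` {1..n})) \<longrightarrow>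
                 complete_plane (d - l) (x' ` {1..n}) L)"
proof -
  let ?N = "{1..n}"
  have D: "DIM(real ^ 'd) = d" using assms(2) by simp
  have N: "finite ?N" "DIM(real ^ 'd) + 1 \<le> card ?N" using D assms by auto
  have l: "2 \<le> l" "l \<le> DIM(real ^ 'd)" using D assms by auto
  obtain x' :: "nat \<Rightarrow> real ^ 'd" where gt: "x' \<in> general_tuples ?N"
    and near: "\<And>i. i \<in> ?N \<Longrightarrow> norm (x i - x' i) < \<epsilon>"
    and gen: "\<And>P. P \<in> patterns DIM(real ^ 'd) l ?N \<Longrightarrow> x' \<notin> incident l P"
    using exists_generic_tuple[OF N l assms(6), of x] by blast
  have inj: "inj_on x' ?N" by (rule general_tuples_inj[OF gt N])
  have "complete_plane (d - l) (x' ` ?N) L"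
    if plane: "is_plane (d - l) L" and trans: "transversal L ((hull) convex ` k_sets k (x' ` ?N))" for L
  proof (rule ccontr)
    assume not_complete: "\<not> complete_plane (d - l) (x' ` ?N) L"
    have L: "affine L" "aff_dim L = int DIM(real ^ 'd) - int l"
      using plane D assms(3) by (auto simp: is_plane_def of_nat_diff)
    have few: "card {i \<in> ?N. x' i \<in> L} \<le> d - l"
    proof (rule ccontr)
      assume "\<not> ?thesis"
      then have "d - l + 1 \<le> card {i \<in> ?N. x' i \<in> L}" by simp
      then obtain T where T: "T \<subseteq> {i \<in> ?N. x' i \<in> L}" "card T = d - l + 1"
        by (rule obtain_subset_with_card_n)
      then have TN: "T \<subseteq> ?N" by blast
      have "x' ` T \<in> k_sets (d - l + 1) (x' ` ?N)"
        using T(2) TN inj_on_subset[OF inj TN] finite_subset[OF TN]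
        by (auto simp: k_sets_def card_image)
      moreover have "x' ` T \<subseteq> L" using T(1) by blast
      ultimately show False using not_complete by (auto simp: complete_plane_def)
    qed
    have hit: "L \<inter> convex hull (x' ` T) \<noteq> {}" if T: "T \<subseteq> ?N" "card T = k" for T
    proof -
      have "x' ` T \<in> k_sets k (x' ` ?N)"
        using T inj_on_subset[OF inj T(1)] finite_subset[OF T(1)]
        by (auto simp: k_sets_def card_image)
      then show ?thesis using trans by (auto simp: transversal_def)
    qed
    have "k > 0" using assms by simp
    obtain v :: "nat \<Rightarrow> real ^ 'd" where v0: "\<And>i. v i = 0 \<longleftrightarrow> x' i \<in> L"
      and bound: "\<And>u. card {i \<in> ?N. u \<bullet> v i > 0} \<le> k - 1"
      and flat: "\<And>F. subspace F \<Longrightarrow> dim F < l \<Longrightarrow> card {i \<in> ?N. v i \<in> F} + l \<le> DIM(real ^ 'd) + dim F + 1"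
      and meet: "\<And>i j. 0 \<in> closed_segment (v i) (v j) \<Longrightarrow> \<exists>q\<in>L. q \<in> closed_segment (x' i) (x' j)"
      using transversal_projection[OF gt N L l(2) \<open>k > 0\<close> hit] by blast
    note flat = flat[unfolded D]
    have card_N: "card ?N = d + 2 * (k - l)" using assms(5) by simp
    \<comment> \<open>With \<open>F = {0}\<close> and \<open>w = 0\<close> the first term of the
      half-space bound is empty and only the count of nonzero vectors remains.\<close>
    have "card {i \<in> ?N. v i \<noteq> 0} \<le> 2 * (k - 1)"
      using halfspace_bound_subspace[OF N(1) bound subspace_single_0, of 0] by simp
    moreover have "card ?N = card {i \<in> ?N. v i = 0} + card {i \<in> ?N. v i \<noteq> 0}"
      using card_Int_Diff[OF N(1), of "{i. v i = 0}"] by (simp add: Int_def set_diff_eq)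
    moreover have "card {i \<in> ?N. v i = 0} \<le> d - l" using few by (simp add: v0)
    ultimately consider "card {i \<in> ?N. v i = 0} + 2 * l = d + 2"
      | "l = 3" "card {i \<in> ?N. v i = 0} + 3 = d"
      using card_N assms(1,3,4) by fastforce
    then show False
    proof cases
      case 1
      obtain P where P: "P \<in> patterns d l ?N" "\<forall>e\<in>P. 0 \<in> closed_segment (v (fst e)) (v (snd e))"
        using antipodal_pattern[OF N(1) assms(1,4) card_N bound flat 1] by blast
      have "x' \<in> incident l P"
        unfolding incident_def using L P(2) meet by blast
      then show False using gen P(1) D by simp
    next
      case 2
      then show False
        using no_odd_halving[of ?N k d v] N(1) assms(4) card_N bound flat by simp
    qed
  qed
  then show ?thesis
    using inj general_tuples_general_position[OF gt N] near by blast
qed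

end
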